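(* Let $(X,\mathcal{B},\mu,T)$ be an ergodic dynamical system. For each integer $k\ge 1$ the factor $Z_{k-1}$ is characteristic for the pointwise convergence of the averages along cubes of $2^k-1$ bounded measurable functions; that is, for every family $(f_\epsilon)_{\epsilon\in\{0,1\}^k\setminus\{0\}}$ of bounded measurable functions $f_\epsilon:X\to\mathbb{C}$, $$\lim_{N\to\infty}\frac{1}{N^k}\sum_{i_1,\dots,i_k=0}^{N-1}\Bigg(\prod_{\epsilon\in\{0,1\}^k\setminus\{0\}} f_\epsilon\big(T^{\epsilon\cdot i}x\big)-\prod_{\epsilon\in\{0,1\}^k\setminus\{0\}} \mathbb{E}(f_\epsilon\mid Z_{k-1})\big(T^{\epsilon\cdot i}x\big)\Bigg)=0$$ for $\mu$-almost every $x\in X$, where $\epsilon\cdot i=\epsilon_1 i_1+\cdots+\epsilon_k i_k$.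
   Context: An ergodic dynamical system $(X,\mathcal{B},\mu,T)$ consists of a probability space $(X,\mathcal{B},\mu)$ and an ergodic measure preserving transformation $T:X\to X$. The seminorms $|||\cdot|||_k$, $k\ge1$, are defined inductively on bounded real-valued measurable functions $f$ by $$|||f|||_1=\Big|\int f\,d\mu\Big|,\qquad |||f|||_{k+1}^{2^{k+1}}=\lim_{H\to\infty}\frac1H\sum_{h=1}^{H}|||f\cdot f\circ T^h|||_k^{2^k}\quad(k\ge1).$$ For $k\ge 0$, $Z_k$ denotes the Host–Kra factor of order $k$, i.e. the $T$-invariant sub-$\sigma$-algebra of $\mathcal{B}$ (unique modulo null sets) such that, for every bounded real-valued measurable $f$, $\mathbb{E}(f\mid Z_k)=0$ if and only if $|||f|||_{k+1}=0$. Thus $Z_0$ is trivial and $Z_1$ is the Kronecker factor. Here $\mathbb{E}(f\mid Z_k)$ is the conditional expectation of $f$ on $Z_k$ (a bounded version is fixed). A factor is characteristic for the pointwise convergence of the averages if replacing each function by its conditional expectation on that factor does not change the almost everywhere asymptotic behaviour of the averages, equivalently (by multilinearity) if the averages converge to $0$ almost everywhere whenever one of the functions has zero conditional expectation on the factor. *)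

theory Defs
  imports "HOL-Probability.Probability"
begin

text \<open>The transformation is not assumed to be invertible.\<close>

locale ergodic_system = prob_space M
  for M :: "'a measure" +
  fixes T :: "'a \<Rightarrow> 'a"
  assumes T_measurable: "T \<in> measurable M M"
    and T_preserving: "distr M M T = M"
    and T_ergodic: "\<And>A. A \<in> sets M \<Longrightarrow> T -` A \<inter> space M = A \<Longrightarrow> prob A = 0 \<or> prob A = 1"

text \<open>
  Host--Kra seminorms, indexed from \<open>1\<close>; the value at index \<open>0\<close> is unspecified. The
  \<open>2\<^sup>k\<^sup>+\<^sup>2\<close>-th root turns the defining identity for the power of the seminorm into
  an explicit equation. The limit exists and is nonnegative for bounded measurable \<open>f\<close> on an
  ergodic system; nothing is asserted in other situations.
\<close>

fun hk_seminorm :: "'a measure \<Rightarrow> ('a \<Rightarrow> 'a) \<Rightarrow> nat \<Rightarrow> ('a \<Rightarrow> real) \<Rightarrow> real" where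
  "hk_seminorm M T (Suc 0) f = \<bar>\<integral>x. f x \<partial>M\<bar>"
| "hk_seminorm M T (Suc (Suc k)) f =
     root (2 ^ (k + 2))
       (lim (\<lambda>H. (\<Sum>h = 1..H. hk_seminorm M T (Suc k) (\<lambda>x. f x * f ((T ^^ h) x)) ^ (2 ^ (k + 1)))
                   / real H))"

text \<open>
  A sub-\<open>\<sigma>\<close>-algebra is represented by a measure \<open>Z\<close> with \<open>subalgebra M Z\<close>; only
  \<open>sets Z\<close> matters, not the measure carried by \<open>Z\<close>. Invariance means
  \<open>T\<^sup>-\<^sup>1 Z \<subseteq> Z\<close>. The factor is determined only modulo null sets, so it is
  described by a predicate. The seminorm paired with the factor of order \<open>k\<close> has index
  \<open>k + 1\<close>.
\<close>

definition host_kra_factor :: "'a measure \<Rightarrow> ('a \<Rightarrow> 'a) \<Rightarrow> nat \<Rightarrow> 'a measure \<Rightarrow> bool" where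
  "host_kra_factor M T k Z \<longleftrightarrow>
     subalgebra M Z \<and> T \<in> measurable Z Z \<and>
     (\<forall>f :: 'a \<Rightarrow> real. f \<in> borel_measurable M \<longrightarrow> bounded (f ` space M) \<longrightarrow>
        ((AE x in M. real_cond_exp M Z f x = 0) \<longleftrightarrow> hk_seminorm M T (k + 1) f = 0))"

definition complex_cond_exp :: "'a measure \<Rightarrow> 'a measure \<Rightarrow> ('a \<Rightarrow> complex) \<Rightarrow> 'a \<Rightarrow> complex" where
  "complex_cond_exp M Z f x =
     Complex (real_cond_exp M Z (\<lambda>y. Re (f y)) x) (real_cond_exp M Z (\<lambda>y. Im (f y)) x)"

text \<open>
  \<^const>\<open>real_cond_exp\<close> is a particular version that need not be bounded everywhere; the
  predicate below describes all everywhere bounded versions.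
\<close>

definition bounded_cond_exp_version ::
    "'a measure \<Rightarrow> 'a measure \<Rightarrow> ('a \<Rightarrow> complex) \<Rightarrow> ('a \<Rightarrow> complex) \<Rightarrow> bool" where
  "bounded_cond_exp_version M Z f g \<longleftrightarrow>
     g \<in> borel_measurable Z \<and> bounded (g ` space M) \<and> (AE x in M. g x = complex_cond_exp M Z f x)"

definition nonzero_vertices :: "nat \<Rightarrow> (nat \<Rightarrow> nat) set" where
  "nonzero_vertices k = ({1..k} \<rightarrow>\<^sub>E {0, 1}) - {\<lambda>j\<in>{1..k}. 0}"

definition index_dot :: "nat \<Rightarrow> (nat \<Rightarrow> nat) \<Rightarrow> (nat \<Rightarrow> nat) \<Rightarrow> nat" where
  "index_dot k \<epsilon> i = (\<Sum>j = 1..k. \<epsilon> j * i j)"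

end

theory Submission
  imports Defs
begin

text \<open>
  By multilinearity it suffices to treat a family in which one factor is a real function \<open>\<phi>\<close> with
  vanishing conditional expectation, hence with vanishing seminorm of order \<open>k\<close>. Splitting the
  cube along a coordinate on which the vertex of \<open>\<phi>\<close> is \<open>1\<close>, the Cauchy--Schwarz inequality
  removes the face without \<open>\<phi>\<close>, and van der Corput's inequality with a fixed range \<open>H\<close> of shifts
  replaces \<open>\<phi>\<close> by the products \<open>\<phi> \<cdot> \<phi> \<circ> T\<^sup>h\<close> on a cube of one dimension less, uniformly in all
  the other factors. After \<open>k - 1\<close> such steps only Birkhoff sums remain, so that for a generic
  point \<open>x\<close> the limit superior of the averages is bounded by a constant times a power of the
  seminorm of order \<open>k\<close> of \<open>\<phi>\<close>.

  This needs the limits in the definition of the seminorms to exist on an arbitrary probability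
  space, where the Host--Kra measures may not be available. They are replaced by monotone linear
  functionals on the algebra generated by functions of one coordinate; the mean ergodic theorem
  for such a functional only uses its order structure and provides the functional on the next cube.
\<close>

text \<open>The delicate point is the order of the limits and of the null sets. The range of shifts
  stays fixed while \<open>N\<close> tends to infinity, so each step involves finitely many
  products; over all steps they are indexed by finite lists of shifts, and one null set serves them
  all, whatever the other factors are. Nothing is known about the averages of those other factors
  along the orbit: after a coordinate is peeled off they become weights that vary from slice to
  slice, hence the uniformity in weights and intervals that \<open>cube_bound\<close> demands. The
  vertex 0, absent from the averages, is filled with the constant 1. The variable of the first
  splitting coordinate serves as base point of a cube of dimension \<open>k - 1\<close>, which is
  why the seminorm of order \<open>k\<close>, and not \<open>k + 1\<close>, controls the averages.
  Existence of the limits in \<open>hk_seminorm\<close> is needed because \<open>lim\<close> carries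
  no information about a divergent sequence, while the estimate uses the actual means over the
  shifts.\<close>

section \<open>Birkhoff's theorem\<close>

context ergodic_system
begin

lemma funpow_measurable [measurable]: "(T ^^ n) \<in> measurable M M"
  by (induction n) (auto intro: measurable_comp T_measurable simp: o_def simp del: o_apply intro!: measurable_compose[OF _ T_measurable])

lemma funpow_in_space: "x \<in> space M \<Longrightarrow> (T ^^ n) x \<in> space M"
  using funpow_measurable[of n] by (rule measurable_space)

lemma integral_T: "f \<in> borel_measurable M \<Longrightarrow> (\<integral>x. f (T x) \<partial>M) = (\<integral>x. f x \<partial>M)"
  for f :: "'a \<Rightarrow> real"
  using integral_distr[OF T_measurable, of f] by (simp add: T_preserving)

lemma integrable_bounded:
  fixes f :: "'a \<Rightarrow> real"
  assumes "f \<in> borel_measurable M" "bounded (f ` space M)"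
  shows "integrable M f"
proof -
  obtain B where "\<And>x. x \<in> space M \<Longrightarrow> norm (f x) \<le> B"
    using assms(2) by (auto simp: bounded_iff)
  then show ?thesis using assms(1) by (intro integrable_const_bound[where B = B]) auto
qed

text \<open>
  \<open>birkhoff_max f n x\<close> is the maximum of the Birkhoff sums of \<open>f\<close> of length at most \<open>n\<close>, the
  empty sum included; the recursion makes Garsia's argument immediate.
\<close>

primrec birkhoff_max :: "('a \<Rightarrow> real) \<Rightarrow> nat \<Rightarrow> 'a \<Rightarrow> real" where
  "birkhoff_max f 0 x = 0"
| "birkhoff_max f (Suc n) x = max 0 (f x + birkhoff_max f n (T x))"

lemma birkhoff_max_nonneg: "0 \<le> birkhoff_max f n x"
  by (cases n) auto

lemma birkhoff_max_mono: "birkhoff_max f n x \<le> birkhoff_max f (Suc n) x"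
  by (induction n arbitrary: x) (auto intro: max.coboundedI2)

lemma birkhoff_sum_Suc:
  "(\<Sum>j<Suc n. f ((T ^^ j) x)) = f x + (\<Sum>j<n. f ((T ^^ j) (T x)))" for f :: "'a \<Rightarrow> real"
  by (simp only: sum.lessThan_Suc_shift funpow_Suc_right) simp

lemma birkhoff_sum_le_max: "(\<Sum>j<n. f ((T ^^ j) x)) \<le> birkhoff_max f n x"
proof (induction n arbitrary: x)
  case (Suc n)
  have "(\<Sum>j<Suc n. f ((T ^^ j) x)) \<le> f x + birkhoff_max f n (T x)"
    unfolding birkhoff_sum_Suc using Suc[of "T x"] by simp
  then show ?case by simp
qed simp

lemma birkhoff_max_bounded:
  assumes "\<And>x. x \<in> space M \<Longrightarrow> \<bar>f x\<bar> \<le> B" "x \<in> space M"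
  shows "\<bar>birkhoff_max f n x\<bar> \<le> n * B"
  using assms(2)
proof (induction n arbitrary: x)
  case (Suc n)
  have "T x \<in> space M" using Suc(2) T_measurable by (simp add: measurable_space)
  then have "\<bar>birkhoff_max f n (T x)\<bar> \<le> n * B" "\<bar>f x\<bar> \<le> B" using Suc assms(1) by auto
  then show ?case by (auto simp: algebra_simps max_def abs_if split: if_splits)
qed simp

lemma birkhoff_max_measurable [measurable]:
  assumes [measurable]: "f \<in> borel_measurable M"
  shows "birkhoff_max f n \<in> borel_measurable M"
proof (induction n)
  case (Suc n)
  note [measurable] = Suc T_measurable
  have "(\<lambda>x. max 0 (f x + birkhoff_max f n (T x))) \<in> borel_measurable M" by measurable
  then show ?case by simp
qed simp

text \<open>Garsia's argument: where the maximum at index \<open>Suc n\<close> is positive,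
  \<open>f x\<close> is that maximum minus the maximum at index \<open>n\<close> along
  \<open>T x\<close>; elsewhere this difference is at most 0. Its integral is nonnegative because
  the maxima increase with \<open>n\<close> and \<open>T\<close> preserves the measure.\<close>

lemma maximal_ergodic:
  fixes f :: "'a \<Rightarrow> real"
  assumes [measurable]: "f \<in> borel_measurable M" and "bounded (f ` space M)"
  shows "0 \<le> (\<integral>x. f x * indicator {x. birkhoff_max f (Suc n) x > 0} x \<partial>M)"
proof -
  note [measurable] = T_measurable
  obtain B where B: "\<And>x. x \<in> space M \<Longrightarrow> \<bar>f x\<bar> \<le> B"
    using assms(2) by (auto simp: bounded_iff)
  have int: "integrable M (birkhoff_max f n)" for n
    using birkhoff_max_bounded[of f B, OF B] by (intro integrable_const_bound[where B = "n * B"]) auto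
  have intT: "integrable M (\<lambda>x. birkhoff_max f n (T x))"
    using int[of n] integrable_distr[OF T_measurable, of "birkhoff_max f n"] by (simp add: T_preserving)
  have intf: "integrable M (\<lambda>x. f x * indicator {x. birkhoff_max f (Suc n) x > 0} x)"
    using integrable_bounded[OF assms] by (rule Bochner_Integration.integrable_bound)
      (auto simp: indicator_def simp del: birkhoff_max.simps)
  have "0 \<le> (\<integral>x. birkhoff_max f (Suc n) x \<partial>M) - (\<integral>x. birkhoff_max f n x \<partial>M)"
    using integral_mono[OF int int, of n "Suc n"] birkhoff_max_mono by (simp del: birkhoff_max.simps)
  also have "\<dots> = (\<integral>x. birkhoff_max f (Suc n) x - birkhoff_max f n (T x) \<partial>M)"
    using Bochner_Integration.integral_diff[OF int[of "Suc n"] intT]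
    by (simp add: integral_T del: birkhoff_max.simps)
  also have "\<dots> \<le> (\<integral>x. f x * indicator {x. birkhoff_max f (Suc n) x > 0} x \<partial>M)"
  proof (rule integral_mono[OF Bochner_Integration.integrable_diff[OF int intT] intf])
    show "birkhoff_max f (Suc n) x - birkhoff_max f n (T x) \<le>
        f x * indicator {x. birkhoff_max f (Suc n) x > 0} x" for x
      using birkhoff_max_nonneg[of f n "T x"] by (simp add: indicator_def max_def)
  qed
  finally show ?thesis .
qed

text \<open>The points with sums unbounded above form an invariant set, null or of full measure by
  ergodicity. In the latter case the sets of the maximal inequality exhaust the space almost
  everywhere, and in the limit the integral of \<open>f\<close> would be nonnegative.\<close>

lemma birkhoff_sums_bounded_above:
  fixes f :: "'a \<Rightarrow> real"
  assumes [measurable]: "f \<in> borel_measurable M" and bdd: "bounded (f ` space M)"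
    and neg: "(\<integral>x. f x \<partial>M) < 0"
  shows "AE x in M. \<exists>c::nat. \<forall>n. (\<Sum>j<n. f ((T ^^ j) x)) \<le> c"
proof -
  define B where "B = {x \<in> space M. \<forall>c::nat. \<exists>n. (\<Sum>j<n. f ((T ^^ j) x)) > c}"
  have [measurable]: "B \<in> sets M" unfolding B_def by measurable
  \<comment> \<open>The sums at \<open>x\<close> and at \<open>T x\<close> differ by
    \<open>f x\<close>, which an enlarged threshold absorbs. Invariance is obtained pointwise
    because \<open>T_ergodic\<close> asks for equality of sets, not equality modulo null
    sets.\<close>
  have TB: "T x \<in> B \<longleftrightarrow> x \<in> B" if "x \<in> space M" for x
  proof -
    have "T x \<in> space M" using that T_measurable by (simp add: measurable_space)
    moreover have "(\<forall>c::nat. \<exists>n. (\<Sum>j<n. f ((T ^^ j) (T x))) > c) \<longleftrightarrow>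
        (\<forall>c::nat. \<exists>n. (\<Sum>j<n. f ((T ^^ j) x)) > c)" (is "?L \<longleftrightarrow> ?R")
    proof
      assume L: ?L
      show ?R
      proof
        fix c :: nat
        obtain n where "(\<Sum>j<n. f ((T ^^ j) (T x))) > (c + nat \<lceil>\<bar>f x\<bar>\<rceil> :: nat)" using L by blast
        then have "(\<Sum>j<Suc n. f ((T ^^ j) x)) > c"
          unfolding birkhoff_sum_Suc by linarith
        then show "\<exists>n. (\<Sum>j<n. f ((T ^^ j) x)) > c" by blast
      qed
    next
      assume R: ?R
      show ?L
      proof
        fix c :: nat
        obtain n where n: "(\<Sum>j<n. f ((T ^^ j) x)) > real (c + nat \<lceil>\<bar>f x\<bar>\<rceil> :: nat)" using R by blast
        have "n \<noteq> 0"
        proof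
          assume "n = 0"
          then have "real (c + nat \<lceil>\<bar>f x\<bar>\<rceil>) < 0" using n by simp
          then show False by (simp only: of_nat_less_0_iff)
        qed
        then obtain m where [simp]: "n = Suc m" by (cases n) auto
        then have "(\<Sum>j<m. f ((T ^^ j) (T x))) > c"
          using n[unfolded \<open>n = Suc m\<close> birkhoff_sum_Suc] by linarith
        then show "\<exists>n. (\<Sum>j<n. f ((T ^^ j) (T x))) > c" by blast
      qed
    qed
    ultimately show ?thesis using that by (simp add: B_def)
  qed
  have "T -` B \<inter> space M = B"
    using TB by (auto simp: B_def)
  then have "prob B = 0 \<or> prob B = 1" by (intro T_ergodic) auto
  moreover have "prob B \<noteq> 1"
  proof
    assume "prob B = 1"
    then have "AE x in M. x \<in> B" by (simp add: AE_in_set_eq_1)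
    then have AE: "AE x in M. (\<lambda>n. f x * indicator {x. birkhoff_max f (Suc n) x > 0} x) \<longlonglongrightarrow> f x"
    proof eventually_elim
      case (elim x)
      then obtain n where n: "(\<Sum>j<n. f ((T ^^ j) x)) > (0::nat)" by (auto simp: B_def dest: spec[of _ "0::nat"])
      have mono: "incseq (\<lambda>n. birkhoff_max f n x)" by (intro incseq_SucI birkhoff_max_mono)
      have "birkhoff_max f (Suc m) x > 0" if "m \<ge> n" for m
      proof -
        have "0 < birkhoff_max f n x" using n birkhoff_sum_le_max[of f x n] by simp
        also have "\<dots> \<le> birkhoff_max f (Suc m) x" using mono that by (simp add: incseq_def del: birkhoff_max.simps)
        finally show ?thesis .
      qed
      then have "eventually (\<lambda>m. f x * indicator {x. birkhoff_max f (Suc m) x > 0} x = f x) sequentially"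
        unfolding eventually_sequentially by (intro exI[of _ n]) (simp del: birkhoff_max.simps)
      then show ?case by (rule tendsto_eventually)
    qed
    have "(\<lambda>n. \<integral>x. f x * indicator {x. birkhoff_max f (Suc n) x > 0} x \<partial>M) \<longlonglongrightarrow> (\<integral>x. f x \<partial>M)"
      using AE integrable_bounded[OF assms(1,2)]
      by (intro integral_dominated_convergence[where w = "\<lambda>x. \<bar>f x\<bar>"])
        (auto simp: indicator_def simp del: birkhoff_max.simps)
    then have "0 \<le> (\<integral>x. f x \<partial>M)"
      using maximal_ergodic[OF assms(1,2)] by (intro LIMSEQ_le_const) auto
    then show False using neg by simp
  qed
  ultimately have "prob B = 0" by blast
  then have "AE x in M. x \<notin> B" by (simp add: AE_iff_measurable[of B] prob_eq_0)
  then show ?thesis using AE_space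
    by eventually_elim (force simp: B_def not_less)
qed

text \<open>Subtracting slightly more than the mean makes the integral negative, so the excess of
  the sums stays bounded and disappears after division by \<open>n\<close>. Countably many margins
  \<open>1 / Suc m\<close> suffice, so one null set serves every \<delta>.\<close>

lemma birkhoff_upper:
  fixes f :: "'a \<Rightarrow> real"
  assumes [measurable]: "f \<in> borel_measurable M" and bdd: "bounded (f ` space M)"
  shows "AE x in M. \<forall>\<delta>>0. eventually (\<lambda>n. (\<Sum>j<n. f ((T ^^ j) x)) \<le> n * ((\<integral>x. f x \<partial>M) + \<delta>)) sequentially"
proof -
  define I where "I = (\<integral>x. f x \<partial>M)"
  have int: "integrable M f" by (rule integrable_bounded[OF assms])
  have "AE x in M. \<exists>c::nat. \<forall>n. (\<Sum>j<n. f ((T ^^ j) x) - (I + 1 / Suc m)) \<le> c" for m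
  proof (rule birkhoff_sums_bounded_above)
    show "bounded ((\<lambda>x. f x - (I + 1 / real (Suc m))) ` space M)"
      using bounded_minus_comp[OF bdd[THEN bounded_subset]] bdd
      using bounded_translation_minus[of "f ` space M" "I + 1 / real (Suc m)"] by (simp add: image_image)
    show "(\<integral>x. f x - (I + 1 / real (Suc m)) \<partial>M) < 0"
      using int by (simp add: I_def prob_space)
  qed measurable
  then have "AE x in M. \<forall>m. \<exists>c::nat. \<forall>n. (\<Sum>j<n. f ((T ^^ j) x) - (I + 1 / Suc m)) \<le> c"
    by (simp add: AE_all_countable)
  then show ?thesis
  proof eventually_elim
    case (elim x)
    show ?case
    proof (intro allI impI)
      fix \<delta> :: real assume "\<delta> > 0"
      then obtain m where m: "1 / Suc m < \<delta> / 2" using nat_approx_posE[of "\<delta>/2"] by auto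
      obtain c :: nat where c: "\<And>n. (\<Sum>j<n. f ((T ^^ j) x) - (I + 1 / Suc m)) \<le> c"
        using elim by blast
      show "eventually (\<lambda>n. (\<Sum>j<n. f ((T ^^ j) x)) \<le> n * ((\<integral>x. f x \<partial>M) + \<delta>)) sequentially"
        unfolding I_def[symmetric]
        using eventually_ge_at_top[of "nat \<lceil>2 * c / \<delta>\<rceil>"]
      proof eventually_elim
        case (elim n)
        have "2 * c / \<delta> \<le> n" using elim by linarith
        then have "c \<le> n * (\<delta> / 2)" using \<open>\<delta> > 0\<close> by (simp add: field_simps)
        moreover have "(\<Sum>j<n. f ((T ^^ j) x)) \<le> c + n * (I + 1 / Suc m)"
          using c[of n] by (simp add: sum_subtractf)
        moreover have "n * (I + 1 / Suc m) \<le> n * (I + \<delta> / 2)"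
          using m by (intro mult_left_mono) auto
        ultimately have "(\<Sum>j<n. f ((T ^^ j) x)) \<le> n * (\<delta> / 2) + n * (I + \<delta> / 2)" by linarith
        also have "\<dots> = n * (I + \<delta>)" by (simp add: algebra_simps)
        finally show ?case .
      qed
    qed
  qed
qed

theorem birkhoff:
  fixes f :: "'a \<Rightarrow> real"
  assumes [measurable]: "f \<in> borel_measurable M" and bdd: "bounded (f ` space M)"
  shows "AE x in M. (\<lambda>n. (\<Sum>j<n. f ((T ^^ j) x)) / n) \<longlonglongrightarrow> (\<integral>x. f x \<partial>M)"
proof -
  have bdd': "bounded ((\<lambda>x. - f x) ` space M)"
    using bdd bounded_uminus[of "f ` space M"] by (simp add: image_image)
  have "AE x in M. \<forall>\<delta>>0. eventually (\<lambda>n. (\<Sum>j<n. - f ((T ^^ j) x)) \<le> n * ((\<integral>x. - f x \<partial>M) + \<delta>)) sequentially"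
    by (rule birkhoff_upper[OF _ bdd']) measurable
  then show ?thesis using birkhoff_upper[OF assms]
  proof eventually_elim
    case (elim x)
    show ?case
    proof (rule tendstoI)
      fix \<delta> :: real assume "\<delta> > 0"
      then have "\<delta> / 2 > 0" by simp
      with elim have
        "eventually (\<lambda>n. (\<Sum>j<n. - f ((T ^^ j) x)) \<le> n * ((\<integral>x. - f x \<partial>M) + \<delta> / 2)) sequentially"
        "eventually (\<lambda>n. (\<Sum>j<n. f ((T ^^ j) x)) \<le> n * ((\<integral>x. f x \<partial>M) + \<delta> / 2)) sequentially"
        by blast+
      then show "eventually (\<lambda>n. dist ((\<Sum>j<n. f ((T ^^ j) x)) / n) (\<integral>x. f x \<partial>M) < \<delta>) sequentially"
        using eventually_gt_at_top[of 0]
      proof eventually_elim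
        case (elim n)
        define S where "S = (\<Sum>j<n. f ((T ^^ j) x))"
        have "S / n \<le> (\<integral>x. f x \<partial>M) + \<delta> / 2" "S / n \<ge> (\<integral>x. f x \<partial>M) - \<delta> / 2"
          using elim by (simp_all add: S_def field_simps sum_negf)
        then show ?case using \<open>\<delta> > 0\<close> unfolding S_def[symmetric] dist_real_def by linarith
      qed
    qed
  qed
qed

end

section \<open>Mean ergodic theorem for monotone functionals\<close>

text \<open>The axioms retain of integration only what survives limits of averages, since the
  functional on the next cube has to satisfy them again. The set \<open>A\<close> need not contain
  limits of its elements, so no projection onto invariant functions is available.\<close>

locale monotone_state =
  fixes A :: "('b \<Rightarrow> real) set" and \<phi> :: "('b \<Rightarrow> real) \<Rightarrow> real" and \<tau> :: "'b \<Rightarrow> 'b"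
  assumes add_closed: "F \<in> A \<Longrightarrow> G \<in> A \<Longrightarrow> (\<lambda>y. F y + G y) \<in> A"
    and mult_closed: "F \<in> A \<Longrightarrow> G \<in> A \<Longrightarrow> (\<lambda>y. F y * G y) \<in> A"
    and const_closed: "(\<lambda>y. c) \<in> A"
    and shift_closed: "F \<in> A \<Longrightarrow> (\<lambda>y. F (\<tau> y)) \<in> A"
    and add: "F \<in> A \<Longrightarrow> G \<in> A \<Longrightarrow> \<phi> (\<lambda>y. F y + G y) = \<phi> F + \<phi> G"
    and scale: "F \<in> A \<Longrightarrow> \<phi> (\<lambda>y. c * F y) = c * \<phi> F"
    and mono: "F \<in> A \<Longrightarrow> G \<in> A \<Longrightarrow> (\<And>y. F y \<le> G y) \<Longrightarrow> \<phi> F \<le> \<phi> G"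
    and shift: "F \<in> A \<Longrightarrow> \<phi> (\<lambda>y. F (\<tau> y)) = \<phi> F"
begin

lemma scale_closed: "F \<in> A \<Longrightarrow> (\<lambda>y. c * F y) \<in> A"
  using mult_closed[OF const_closed] .

lemma divide_closed: "F \<in> A \<Longrightarrow> (\<lambda>y. F y / c) \<in> A"
  using scale_closed[of F "1 / c"] by simp

lemma diff_closed: "F \<in> A \<Longrightarrow> G \<in> A \<Longrightarrow> (\<lambda>y. F y - G y) \<in> A"
  using add_closed[OF _ scale_closed[of G "-1"]] by simp

lemma power2_closed: "F \<in> A \<Longrightarrow> (\<lambda>y. (F y)\<^sup>2) \<in> A"
  using mult_closed[of F F] by (simp add: power2_eq_square)

lemma sum_closed: "finite I \<Longrightarrow> (\<And>i. i \<in> I \<Longrightarrow> F i \<in> A) \<Longrightarrow> (\<lambda>y. \<Sum>i\<in>I. F i y) \<in> A"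
proof (induction I rule: finite_induct)
  case empty show ?case using const_closed[of 0] by simp
qed (simp add: add_closed)

lemma funpow_closed: "F \<in> A \<Longrightarrow> (\<lambda>y. F ((\<tau> ^^ n) y)) \<in> A"
proof (induction n arbitrary: F)
  case (Suc n)
  show ?case using Suc.IH[OF shift_closed[OF Suc.prems]] by simp
qed simp

lemma funpow_shift: "F \<in> A \<Longrightarrow> \<phi> (\<lambda>y. F ((\<tau> ^^ n) y)) = \<phi> F"
proof (induction n arbitrary: F)
  case (Suc n)
  show ?case using Suc.IH[OF shift_closed[OF Suc.prems]] shift[OF Suc.prems] by simp
qed simp

lemma zero: "\<phi> (\<lambda>y. 0) = 0"
  using scale[OF const_closed, of 0 0] by simp

lemma sum: "finite I \<Longrightarrow> (\<And>i. i \<in> I \<Longrightarrow> F i \<in> A) \<Longrightarrow> \<phi> (\<lambda>y. \<Sum>i\<in>I. F i y) = (\<Sum>i\<in>I. \<phi> (F i))"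
proof (induction I rule: finite_induct)
  case empty then show ?case using zero by simp
next
  case (insert i I)
  then show ?case by (simp add: add sum_closed)
qed

lemma divide: "F \<in> A \<Longrightarrow> \<phi> (\<lambda>y. F y / c) = \<phi> F / c"
  using scale[of F "1 / c"] by simp

lemma diff: "F \<in> A \<Longrightarrow> G \<in> A \<Longrightarrow> \<phi> (\<lambda>y. F y - G y) = \<phi> F - \<phi> G"
  using add[OF _ scale_closed[of G "-1"], of F] scale[of G "-1"] by simp

lemma nonneg: "F \<in> A \<Longrightarrow> (\<And>y. 0 \<le> F y) \<Longrightarrow> 0 \<le> \<phi> F"
  using mono[OF const_closed[of 0], of F] zero by simp

definition avg :: "nat \<Rightarrow> ('b \<Rightarrow> real) \<Rightarrow> 'b \<Rightarrow> real" where
  "avg H F y = (\<Sum>h=1..H. F ((\<tau> ^^ h) y)) / H"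

lemma avg_closed: "F \<in> A \<Longrightarrow> avg H F \<in> A"
  unfolding avg_def using divide_closed[OF sum_closed[of "{1..H}"]] funpow_closed by simp

section \<open>The squared seminorm of a monotone functional and its minimisation\<close>

definition sq :: "('b \<Rightarrow> real) \<Rightarrow> real" where
  "sq F = \<phi> (\<lambda>y. (F y)\<^sup>2)"

lemma sq_nonneg: "F \<in> A \<Longrightarrow> 0 \<le> sq F"
  unfolding sq_def by (intro nonneg power2_closed) auto

text \<open>A small \<open>t\<close> keeps the coefficient of the first term near 1, as the
  comparison with an infimum in \<open>avg_Cauchy\<close> requires; the plain factor 2 would be too
  crude there.\<close>

lemma sq_add_le:
  assumes "F \<in> A" "G \<in> A" "t > 0"
  shows "sq (\<lambda>y. F y + G y) \<le> (1 + t) * sq F + (1 + 1 / t) * sq G"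
proof -
  have "(F y + G y)\<^sup>2 \<le> (1 + t) * (F y)\<^sup>2 + (1 + 1 / t) * (G y)\<^sup>2" for y
  proof -
    have "0 \<le> (t * F y - G y)\<^sup>2 / t" using \<open>t > 0\<close> by simp
    also have "\<dots> = (1 + t) * (F y)\<^sup>2 + (1 + 1 / t) * (G y)\<^sup>2 - (F y + G y)\<^sup>2"
      using \<open>t > 0\<close> by (simp add: field_simps power2_eq_square)
    finally show ?thesis by simp
  qed
  then have "sq (\<lambda>y. F y + G y) \<le> \<phi> (\<lambda>y. (1 + t) * (F y)\<^sup>2 + (1 + 1 / t) * (G y)\<^sup>2)"
    unfolding sq_def using assms by (intro mono power2_closed add_closed scale_closed)
  also have "\<dots> = (1 + t) * sq F + (1 + 1 / t) * sq G"
    using assms by (simp add: add scale scale_closed power2_closed sq_def)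
  finally show ?thesis .
qed

lemma sq_sum_le:
  assumes "finite I" "\<And>i. i \<in> I \<Longrightarrow> F i \<in> A"
  shows "sq (\<lambda>y. \<Sum>i\<in>I. F i y) \<le> card I * (\<Sum>i\<in>I. sq (F i))"
proof -
  have "sq (\<lambda>y. \<Sum>i\<in>I. F i y) \<le> \<phi> (\<lambda>y. card I * (\<Sum>i\<in>I. (F i y)\<^sup>2))"
    unfolding sq_def using assms
    by (intro mono power2_closed scale_closed sum_closed)
      (use sum_squared_le_sum_of_squares in \<open>auto simp: mult.commute\<close>)
  also have "\<dots> = card I * (\<Sum>i\<in>I. sq (F i))"
    using assms by (simp add: scale sum sum_closed power2_closed sq_def)
  finally show ?thesis .
qed

lemma sq_divide: "F \<in> A \<Longrightarrow> sq (\<lambda>y. F y / c) = sq F / c\<^sup>2"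
  by (simp add: sq_def power_divide divide power2_closed)

lemma sq_funpow: "F \<in> A \<Longrightarrow> sq (\<lambda>y. F ((\<tau> ^^ n) y)) = sq F"
  unfolding sq_def by (rule funpow_shift[OF power2_closed])

lemma sq_avg_le: "F \<in> A \<Longrightarrow> sq (avg H F) \<le> sq F"
proof -
  assume F: "F \<in> A"
  have "sq (avg H F) = sq (\<lambda>y. \<Sum>h=1..H. F ((\<tau> ^^ h) y)) / (real H)\<^sup>2"
    unfolding avg_def using F by (intro sq_divide sum_closed funpow_closed) auto
  also have "\<dots> \<le> (H * (\<Sum>h=1..H. sq F)) / (real H)\<^sup>2"
    using sq_sum_le[of "{1..H}" "\<lambda>h y. F ((\<tau> ^^ h) y)"] F
    by (intro divide_right_mono) (auto simp: funpow_closed sq_funpow)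
  also have "\<dots> \<le> sq F"
    using sq_nonneg[OF F] by (cases "H = 0") (auto simp: power2_eq_square)
  finally show ?thesis .
qed

text \<open>
  The averages of \<open>G\<close> asymptotically minimise \<open>sq\<close> on this set, which contains them and is closed
  under midpoints, so the parallelogram identity makes them a Cauchy sequence.
\<close>

definition asymp :: "('b \<Rightarrow> real) \<Rightarrow> ('b \<Rightarrow> real) set" where
  "asymp G = {C \<in> A. (\<lambda>H. sq (\<lambda>y. avg H C y - avg H G y)) \<longlonglongrightarrow> 0}"

lemma asymp_midpoint:
  assumes G: "G \<in> A" and "C \<in> asymp G" "D \<in> asymp G"
  shows "(\<lambda>y. (C y + D y) / 2) \<in> asymp G"
proof -
  have CD: "C \<in> A" "D \<in> A" using assms by (auto simp: asymp_def)
  have *: "avg H (\<lambda>y. (C y + D y) / 2) y - avg H G y =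
      (avg H C y - avg H G y) / 2 + (avg H D y - avg H G y) / 2" for H y
    unfolding avg_def by (simp add: sum.distrib add_divide_distrib diff_divide_distrib flip: sum_divide_distrib)
  have "(\<lambda>H. sq (\<lambda>y. avg H (\<lambda>y. (C y + D y) / 2) y - avg H G y)) \<longlonglongrightarrow> 0"
  proof (rule tendsto_sandwich[OF _ _ tendsto_const])
    show "eventually (\<lambda>H. 0 \<le> sq (\<lambda>y. avg H (\<lambda>y. (C y + D y) / 2) y - avg H G y)) sequentially"
      using CD G by (intro always_eventually allI sq_nonneg diff_closed avg_closed divide_closed add_closed)
    show "eventually (\<lambda>H. sq (\<lambda>y. avg H (\<lambda>y. (C y + D y) / 2) y - avg H G y) \<le>
      2 * (sq (\<lambda>y. avg H C y - avg H G y) / 2\<^sup>2) + 2 * (sq (\<lambda>y. avg H D y - avg H G y) / 2\<^sup>2)) sequentially"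
      (is "eventually (\<lambda>H. ?l H \<le> ?r H) _")
    proof (intro always_eventually allI)
      fix H
      have "(\<lambda>y. avg H C y - avg H G y) \<in> A" "(\<lambda>y. avg H D y - avg H G y) \<in> A"
        using CD G by (intro diff_closed avg_closed; simp)+
      then show "?l H \<le> ?r H"
        unfolding * using sq_add_le[OF divide_closed[of _ 2] divide_closed[of _ 2] zero_less_one]
        by (simp add: sq_divide)
    qed
    show "(\<lambda>H. 2 * (sq (\<lambda>y. avg H C y - avg H G y) / 2\<^sup>2) +
        2 * (sq (\<lambda>y. avg H D y - avg H G y) / 2\<^sup>2)) \<longlonglongrightarrow> 0"
      using assms(2,3) by (auto simp: asymp_def intro!: tendsto_eq_intros)
  qed
  moreover have "(\<lambda>y. (C y + D y) / 2) \<in> A" using CD by (intro divide_closed add_closed)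
  ultimately show ?thesis by (simp add: asymp_def)
qed

lemma avg_shift_diff:
  "avg H (\<lambda>z. G ((\<tau> ^^ n) z)) y - avg H G y =
    (\<Sum>h=1..n. G ((\<tau> ^^ (H + h)) y) - G ((\<tau> ^^ h) y)) / H"
proof -
  have *: "(\<Sum>h=1..H. g (h + n)) - (\<Sum>h=1..H. g h) = (\<Sum>h=1..n. g (H + h) - g h)" for g :: "nat \<Rightarrow> real"
  proof (induction n)
    case (Suc n)
    have "(\<Sum>h=1..H. g (h + Suc n)) - (\<Sum>h=1..H. g (h + n)) = g (H + Suc n) - g (Suc n)"
      by (induction H) auto
    then show ?case using Suc by simp
  qed simp
  show ?thesis
    unfolding avg_def using *[of "\<lambda>h. G ((\<tau> ^^ h) y)"]
    by (simp add: funpow_add add.commute[of _ n] flip: diff_divide_distrib)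
qed

lemma sq_avg_shift_diff:
  assumes "G \<in> A"
  shows "sq (\<lambda>y. avg H (\<lambda>z. G ((\<tau> ^^ n) z)) y - avg H G y) \<le> 4 * (real n)\<^sup>2 * sq G / (real H)\<^sup>2"
proof -
  let ?D = "\<lambda>h y. G ((\<tau> ^^ (H + h)) y) - G ((\<tau> ^^ h) y)"
  have D: "?D h \<in> A" for h using assms by (intro diff_closed funpow_closed)
  have "sq (?D h) \<le> 4 * sq G" for h
  proof -
    have "sq (?D h) = sq (\<lambda>y. G ((\<tau> ^^ (H + h)) y) + (-1) * G ((\<tau> ^^ h) y))" by simp
    also have "\<dots> \<le> 2 * sq (\<lambda>y. G ((\<tau> ^^ (H + h)) y)) + 2 * sq (\<lambda>y. (-1) * G ((\<tau> ^^ h) y))"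
      using sq_add_le[OF funpow_closed[OF assms, of "H + h"]
          scale_closed[OF funpow_closed[OF assms, of h], of "-1"] zero_less_one] by simp
    also have "\<dots> = 4 * sq G"
      using sq_funpow[OF assms] by (simp add: sq_def)
    finally show ?thesis .
  qed
  then have "(\<Sum>h=1..n. sq (?D h)) \<le> (\<Sum>h=1..n. 4 * sq G)" by (intro sum_mono)
  then have "n * (\<Sum>h=1..n. sq (?D h)) \<le> n * (\<Sum>h=1..n. 4 * sq G)" by (intro mult_left_mono) auto
  then have "sq (\<lambda>y. \<Sum>h=1..n. ?D h y) \<le> 4 * (real n)\<^sup>2 * sq G"
    using sq_sum_le[of "{1..n}" ?D] D by (simp add: power2_eq_square mult_ac)
  then show ?thesis
    unfolding avg_shift_diff using D by (simp add: sq_divide sum_closed divide_right_mono)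
qed

text \<open>Averaging an average amounts to averaging shifts of \<open>G\<close>, and a shift by a
  fixed \<open>n\<close> changes long averages only at the ends of the window. The index is
  \<open>Suc N\<close> since \<open>avg 0 G\<close> is the zero function.\<close>

lemma avg_in_asymp:
  assumes "G \<in> A"
  shows "avg (Suc N) G \<in> asymp G"
proof -
  let ?N = "Suc N"
  let ?D = "\<lambda>H n y. avg H (\<lambda>z. G ((\<tau> ^^ n) z)) y - avg H G y"
  have D: "?D H n \<in> A" for H n using assms by (intro diff_closed avg_closed funpow_closed)
  have eq: "avg H (avg ?N G) y - avg H G y = (\<Sum>n=1..?N. ?D H n y) / ?N" for H y
  proof -
    have "avg H (avg ?N G) y = (\<Sum>n=1..?N. avg H (\<lambda>z. G ((\<tau> ^^ n) z)) y) / ?N"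
      unfolding avg_def by (subst sum_divide_distrib[symmetric], subst sum.swap)
        (simp add: sum_divide_distrib[symmetric] mult.commute del: sum.cl_ivl_Suc)
    moreover have "avg H G y = (\<Sum>n=1..?N. avg H G y) / ?N" by simp
    ultimately show ?thesis by (simp only: sum_subtractf diff_divide_distrib)
  qed
  have bound: "sq (\<lambda>y. avg H (avg ?N G) y - avg H G y) \<le> (?N * (\<Sum>n=1..?N. 4 * (real n)\<^sup>2 * sq G)) / (real ?N)\<^sup>2 / (real H)\<^sup>2" for H
  proof -
    have "sq (\<lambda>y. avg H (avg ?N G) y - avg H G y) = sq (\<lambda>y. \<Sum>n=1..?N. ?D H n y) / (real ?N)\<^sup>2"
      unfolding eq using D by (intro sq_divide sum_closed) auto
    also have "\<dots> \<le> (?N * (\<Sum>n=1..?N. sq (?D H n))) / (real ?N)\<^sup>2"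
      using sq_sum_le[of "{1..?N}" "?D H"] D by (intro divide_right_mono) (auto simp del: sum.cl_ivl_Suc)
    also have "\<dots> \<le> (?N * (\<Sum>n=1..?N. 4 * (real n)\<^sup>2 * sq G / (real H)\<^sup>2)) / (real ?N)\<^sup>2"
      by (intro divide_right_mono mult_left_mono sum_mono sq_avg_shift_diff assms) auto
    also have "\<dots> = (?N * (\<Sum>n=1..?N. 4 * (real n)\<^sup>2 * sq G)) / (real ?N)\<^sup>2 / (real H)\<^sup>2"
      by (simp add: sum_divide_distrib[symmetric] del: sum.cl_ivl_Suc)
    finally show ?thesis .
  qed
  have lim: "(\<lambda>H::nat. c / (real H)\<^sup>2) \<longlonglongrightarrow> 0" for c :: real
    using tendsto_mult[OF tendsto_mult[OF lim_1_over_n lim_1_over_n] tendsto_const[of c]]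
    by (simp add: power2_eq_square field_simps)
  have "(\<lambda>H. sq (\<lambda>y. avg H (avg ?N G) y - avg H G y)) \<longlonglongrightarrow> 0"
    by (rule tendsto_sandwich[OF _ always_eventually[OF allI[OF bound]] tendsto_const lim])
      (intro always_eventually allI sq_nonneg diff_closed avg_closed assms)
  then show ?thesis using assms by (simp add: asymp_def avg_closed)
qed

lemma parallelogram:
  assumes "F \<in> A" "G \<in> A"
  shows "sq (\<lambda>y. F y - G y) = 2 * sq F + 2 * sq G - 4 * sq (\<lambda>y. (F y + G y) / 2)"
proof -
  have "(F y - G y)\<^sup>2 = (2 * (F y)\<^sup>2 + 2 * (G y)\<^sup>2) - 4 * ((F y + G y) / 2)\<^sup>2" for y
    by (simp add: power2_eq_square field_simps)
  then have "sq (\<lambda>y. F y - G y) = \<phi> (\<lambda>y. (2 * (F y)\<^sup>2 + 2 * (G y)\<^sup>2) - 4 * ((F y + G y) / 2)\<^sup>2)"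
    by (simp add: sq_def)
  also have "\<dots> = 2 * sq F + 2 * sq G - 4 * sq (\<lambda>y. (F y + G y) / 2)"
    using assms unfolding sq_def
    by (simp only: diff add scale scale_closed add_closed power2_closed divide_closed)
  finally show ?thesis .
qed

text \<open>Averaging does not increase \<open>sq\<close>, so the averages of a nearly minimal
  \<open>C\<close> are nearly minimal; those of \<open>G\<close> come close to them by the
  definition of \<open>asymp\<close>.\<close>

lemma avg_Cauchy:
  assumes G: "G \<in> A" and "\<epsilon> > 0"
  shows "\<exists>H0>0. \<forall>H\<ge>H0. \<forall>K\<ge>H0. sq (\<lambda>y. avg H G y - avg K G y) \<le> \<epsilon>"
proof -
  define d where "d = Inf (sq ` asymp G)"
  have bdd: "bdd_below (sq ` asymp G)"
    by (rule bdd_belowI[of _ 0]) (auto simp: asymp_def sq_nonneg)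
  have ne: "sq ` asymp G \<noteq> {}" using avg_in_asymp[OF G, of 0] by blast
  have "Inf (sq ` asymp G) < d + \<epsilon> / 16" using \<open>\<epsilon> > 0\<close> by (simp add: d_def)
  then obtain C where C: "C \<in> asymp G" "sq C < d + \<epsilon> / 16"
    using cInf_lessD[OF ne] by blast
  then have CA: "C \<in> A" by (simp add: asymp_def)
  have "d \<ge> 0" unfolding d_def by (rule cInf_greatest[OF ne]) (auto simp: asymp_def sq_nonneg)
  \<comment> \<open>Since \<open>sq C\<close> is below \<open>d + \<epsilon>\<close>, the loss
    \<open>t * sq C\<close> is at most \<open>\<epsilon> / 16\<close>. Three errors of this size
    remain below \<open>\<epsilon> / 4\<close>.\<close>
  define t where "t = \<epsilon> / 16 / (d + \<epsilon>)"
  have t: "t > 0" using \<open>\<epsilon> > 0\<close> \<open>d \<ge> 0\<close> by (simp add: t_def)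
  have "t * sq C \<le> \<epsilon> / 16"
  proof -
    have "sq C \<le> d + \<epsilon>" using C(2) \<open>\<epsilon> > 0\<close> by simp
    then have "t * sq C \<le> t * (d + \<epsilon>)" using t by (intro mult_left_mono) auto
    also have "\<dots> = \<epsilon> / 16" using \<open>d \<ge> 0\<close> \<open>\<epsilon> > 0\<close> nonzero_divide_eq_eq[of "d + \<epsilon>" "\<epsilon> / 16" t] by (simp only: t_def) linarith
    finally show ?thesis .
  qed
  have "(\<lambda>H. (1 + 1 / t) * sq (\<lambda>y. avg H C y - avg H G y)) \<longlonglongrightarrow> (1 + 1 / t) * 0"
    using C(1) by (intro tendsto_mult tendsto_const) (simp add: asymp_def)
  then have "eventually (\<lambda>H. (1 + 1 / t) * sq (\<lambda>y. avg H C y - avg H G y) < \<epsilon> / 16) sequentially"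
    using \<open>\<epsilon> > 0\<close> by (intro order_tendstoD) auto
  then obtain H0 where H0: "\<And>H. H \<ge> H0 \<Longrightarrow> (1 + 1 / t) * sq (\<lambda>y. avg H C y - avg H G y) < \<epsilon> / 16"
    by (auto simp: eventually_sequentially)
  have small: "sq (avg H G) \<le> d + \<epsilon> / 4" if "H \<ge> H0" for H
  proof -
    have "sq (avg H G) = sq (\<lambda>y. avg H C y + - 1 * (avg H C y - avg H G y))" by simp
    also have "\<dots> \<le> (1 + t) * sq (avg H C) + (1 + 1 / t) * sq (\<lambda>y. - 1 * (avg H C y - avg H G y))"
      using CA G t by (intro sq_add_le scale_closed diff_closed avg_closed)
    also have "sq (\<lambda>y. - 1 * (avg H C y - avg H G y)) = sq (\<lambda>y. avg H C y - avg H G y)"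
      by (simp add: sq_def power2_commute)
    also have "(1 + t) * sq (avg H C) + (1 + 1 / t) * sq (\<lambda>y. avg H C y - avg H G y) \<le>
        (1 + t) * sq C + \<epsilon> / 16"
      using sq_avg_le[OF CA, of H] H0[OF that] t by (intro add_mono mult_left_mono) auto
    also have "\<dots> \<le> d + \<epsilon> / 4" using C(2) \<open>t * sq C \<le> \<epsilon> / 16\<close> \<open>\<epsilon> > 0\<close> by (simp add: algebra_simps)
    finally show ?thesis .
  qed
  \<comment> \<open>\<open>Suc H0\<close> excludes the average of length 0. The parallelogram
    identity yields \<open>2 * (d + \<epsilon> / 4) + 2 * (d + \<epsilon> / 4) - 4 * d =
    \<epsilon>\<close>.\<close>
  have "sq (\<lambda>y. avg H G y - avg K G y) \<le> \<epsilon>" if "H \<ge> Suc H0" "K \<ge> Suc H0" for H K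
  proof -
    have "avg H G \<in> asymp G" "avg K G \<in> asymp G"
      using that avg_in_asymp[OF G, of "H - 1"] avg_in_asymp[OF G, of "K - 1"] by auto
    then have "(\<lambda>y. (avg H G y + avg K G y) / 2) \<in> asymp G" by (rule asymp_midpoint[OF G])
    then have "d \<le> sq (\<lambda>y. (avg H G y + avg K G y) / 2)"
      unfolding d_def using bdd by (intro cInf_lower) auto
    then show ?thesis
      using small[of H] small[of K] that parallelogram[OF avg_closed[OF G] avg_closed[OF G], of H K] by simp
  qed
  then show ?thesis by blast
qed

text \<open>No limit of the averages is sought inside \<open>A\<close>: being Cauchy for
  \<open>sq\<close>, they have Cauchy pairings with \<open>F\<close>, and completeness of the reals
  suffices. The weighted inequality \<open>young\<close> stands in for Cauchy--Schwarz and tolerates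
  \<open>sq F = 0\<close>.\<close>

theorem mean_ergodic:
  assumes F: "F \<in> A" and G: "G \<in> A"
  shows "convergent (\<lambda>H. (\<Sum>h=1..H. \<phi> (\<lambda>y. F y * G ((\<tau> ^^ h) y))) / H)"
proof -
  have eq: "(\<Sum>h=1..H. \<phi> (\<lambda>y. F y * G ((\<tau> ^^ h) y))) / H = \<phi> (\<lambda>y. F y * avg H G y)" for H
  proof -
    have "\<phi> (\<lambda>y. F y * avg H G y) = \<phi> (\<lambda>y. (\<Sum>h=1..H. F y * G ((\<tau> ^^ h) y)) / H)"
      by (simp add: avg_def sum_distrib_left)
    also have "\<dots> = (\<Sum>h=1..H. \<phi> (\<lambda>y. F y * G ((\<tau> ^^ h) y))) / H"
      using assms by (simp add: divide sum sum_closed mult_closed funpow_closed)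
    finally show ?thesis by simp
  qed
  have young: "\<phi> (\<lambda>y. F y * D y) \<le> t * sq F + sq D / t" if "D \<in> A" "t > 0" for D t
  proof -
    have "F y * D y \<le> t * (F y)\<^sup>2 + (D y)\<^sup>2 / t" for y
    proof -
      have "0 \<le> ((t * F y - D y)\<^sup>2 + t\<^sup>2 * (F y)\<^sup>2 + (D y)\<^sup>2) / (2 * t)" using \<open>t > 0\<close> by simp
      also have "\<dots> = t * (F y)\<^sup>2 + (D y)\<^sup>2 / t - F y * D y"
        using \<open>t > 0\<close> by (simp add: field_simps power2_eq_square)
      finally show ?thesis by simp
    qed
    then have "\<phi> (\<lambda>y. F y * D y) \<le> \<phi> (\<lambda>y. t * (F y)\<^sup>2 + (D y)\<^sup>2 / t)"
      using that F by (intro mono mult_closed add_closed scale_closed divide_closed power2_closed)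
    also have "\<dots> = t * sq F + sq D / t"
      using that F by (simp add: add scale divide scale_closed divide_closed power2_closed sq_def)
    finally show ?thesis .
  qed
  have "Cauchy (\<lambda>H. \<phi> (\<lambda>y. F y * avg H G y))"
  proof (rule metric_CauchyI)
    fix e :: real assume "e > 0"
    define t where "t = e / 4 / (sq F + 1)"
    have "sq F \<ge> 0" by (rule sq_nonneg[OF F])
    then have t: "t > 0" using \<open>e > 0\<close> by (simp add: t_def)
    have tF: "t * sq F \<le> e / 4"
    proof -
      have "t * sq F \<le> t * (sq F + 1)" using t by simp
      also have "\<dots> = e / 4" using \<open>sq F \<ge> 0\<close> nonzero_divide_eq_eq[of "sq F + 1" "e / 4" t] by (simp only: t_def) linarith
      finally show ?thesis .
    qed
    obtain H0 where H0: "\<And>H K. H \<ge> H0 \<Longrightarrow> K \<ge> H0 \<Longrightarrow> sq (\<lambda>y. avg H G y - avg K G y) \<le> t * (e / 4)"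
      using avg_Cauchy[OF G, of "t * (e / 4)"] t \<open>e > 0\<close> by auto
    \<comment> \<open>A one-sided bound is enough, as \<open>H\<close> and \<open>K\<close> may be
      exchanged.\<close>
    have "\<phi> (\<lambda>y. F y * avg H G y) - \<phi> (\<lambda>y. F y * avg K G y) < e" if "H \<ge> H0" "K \<ge> H0" for H K
    proof -
      have "\<phi> (\<lambda>y. F y * avg H G y) - \<phi> (\<lambda>y. F y * avg K G y) = \<phi> (\<lambda>y. F y * (avg H G y - avg K G y))"
        using assms by (simp add: right_diff_distrib diff mult_closed avg_closed)
      also have "\<dots> \<le> t * sq F + sq (\<lambda>y. avg H G y - avg K G y) / t"
        using t by (intro young diff_closed avg_closed G)
      also have "sq (\<lambda>y. avg H G y - avg K G y) / t \<le> e / 4"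
        using H0[OF that] t by (simp add: field_simps)
      finally show ?thesis using tF \<open>e > 0\<close> by linarith
    qed
    then show "\<exists>N. \<forall>m\<ge>N. \<forall>n\<ge>N. dist (\<phi> (\<lambda>y. F y * avg m G y)) (\<phi> (\<lambda>y. F y * avg n G y)) < e"
      unfolding dist_real_def abs_less_iff by (intro exI[of _ H0]) force
  qed
  then show ?thesis unfolding eq by (simp add: Cauchy_convergent_iff)
qed

end

section \<open>Functionals on cubes and the seminorms\<close>

text \<open>
  A point of the \<open>k\<close>-dimensional cube space is a sequence whose first \<open>2 ^ k\<close> entries matter. Doubling
  interleaves a point with its image under the diagonal action of \<open>T ^^ h\<close>.
\<close>

inductive_set cylinder_algebra :: "'a measure \<Rightarrow> ((nat \<Rightarrow> 'a) \<Rightarrow> real) set" for M where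
  const: "(\<lambda>y. c) \<in> cylinder_algebra M"
| coord: "f \<in> borel_measurable M \<Longrightarrow> bounded (f ` space M) \<Longrightarrow> (\<lambda>y. f (y v)) \<in> cylinder_algebra M"
| add: "F \<in> cylinder_algebra M \<Longrightarrow> G \<in> cylinder_algebra M \<Longrightarrow> (\<lambda>y. F y + G y) \<in> cylinder_algebra M"
| mult: "F \<in> cylinder_algebra M \<Longrightarrow> G \<in> cylinder_algebra M \<Longrightarrow> (\<lambda>y. F y * G y) \<in> cylinder_algebra M"

text \<open>On a doubled point a product separating even and odd entries becomes
  \<open>P y * Q ((diag ^^ h) y)\<close>, the kind of correlation that \<open>mean_ergodic\<close>
  controls.\<close>

inductive_set split_algebra :: "'a measure \<Rightarrow> ((nat \<Rightarrow> 'a) \<Rightarrow> real) set" for M where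
  tensor: "P \<in> cylinder_algebra M \<Longrightarrow> Q \<in> cylinder_algebra M \<Longrightarrow>
    (\<lambda>y. P (\<lambda>v. y (2 * v)) * Q (\<lambda>v. y (2 * v + 1))) \<in> split_algebra M"
| add: "F \<in> split_algebra M \<Longrightarrow> G \<in> split_algebra M \<Longrightarrow> (\<lambda>y. F y + G y) \<in> split_algebra M"

lemma split_algebra_mult:
  assumes "F \<in> split_algebra M" "G \<in> split_algebra M"
  shows "(\<lambda>y. F y * G y) \<in> split_algebra M"
  using assms(1)
proof induction
  case (tensor P Q)
  show ?case using assms(2)
  proof induction
    case (tensor P' Q')
    then show ?case
      using split_algebra.tensor[OF cylinder_algebra.mult[of P M P'] cylinder_algebra.mult[of Q M Q']]
        \<open>P \<in> _\<close> \<open>Q \<in> _\<close> by (simp add: mult_ac)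
  next
    case (add F G)
    then show ?case by (simp add: distrib_left split_algebra.add)
  qed
next
  case (add F F')
  then show ?case by (simp add: distrib_right split_algebra.add)
qed

lemma cylinder_algebra_split: "F \<in> cylinder_algebra M \<Longrightarrow> F \<in> split_algebra M"
proof (induction rule: cylinder_algebra.induct)
  case (const c)
  show ?case
    using split_algebra.tensor[OF cylinder_algebra.const[of c] cylinder_algebra.const[of 1]] by simp
next
  case (coord f v)
  show ?case
  proof (cases "even v")
    case True
    then have "2 * (v div 2) = v" by simp
    then show ?thesis
      using split_algebra.tensor[OF cylinder_algebra.coord[OF coord, of "v div 2"] cylinder_algebra.const[of 1]]
      by simp
  next
    case False
    then have "2 * (v div 2) + 1 = v" by simp
    then show ?thesis
      using split_algebra.tensor[OF cylinder_algebra.const[of 1] cylinder_algebra.coord[OF coord, of "v div 2"]]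
      by simp
  qed
qed (simp_all add: split_algebra.add split_algebra_mult)

lemma prod_even_odd: "(\<Prod>v<2 * n. g v) = (\<Prod>v<n. g (2 * v) * g (2 * v + 1))"
  for g :: "nat \<Rightarrow> real"
  by (induction n) (simp_all add: mult_ac)

context ergodic_system
begin

text \<open>Interleaving, as opposed to appending the moved copy, works without reference to the
  dimension: entry \<open>v\<close> always comes from entry \<open>v div 2\<close>.\<close>

definition double :: "nat \<Rightarrow> (nat \<Rightarrow> 'a) \<Rightarrow> nat \<Rightarrow> 'a" where
  "double h y v = (if even v then y (v div 2) else (T ^^ h) (y (v div 2)))"

definition diag :: "(nat \<Rightarrow> 'a) \<Rightarrow> nat \<Rightarrow> 'a" where
  "diag y v = T (y v)"

lemma diag_funpow: "(diag ^^ h) y = (\<lambda>v. (T ^^ h) (y v))"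
  by (induction h) (auto simp: diag_def)

lemma double_diag: "double h (diag y) = diag (double h y)"
  by (auto simp: double_def diag_def fun_eq_iff simp flip: funpow_swap1)

lemma bounded_funpow: "bounded (f ` space M) \<Longrightarrow> bounded ((\<lambda>x. f ((T ^^ h) x)) ` space M)"
  for f :: "'a \<Rightarrow> real"
  by (rule bounded_subset) (auto simp: funpow_in_space)

lemma cylinder_algebra_double:
  "F \<in> cylinder_algebra M \<Longrightarrow> (\<lambda>y. F (double h y)) \<in> cylinder_algebra M"
proof (induction rule: cylinder_algebra.induct)
  case (coord f v)
  then show ?case
    using cylinder_algebra.coord[OF _ bounded_funpow[OF coord(2)], of h "v div 2"]
    by (cases "even v") (auto simp: double_def intro: cylinder_algebra.coord)
qed (simp_all add: cylinder_algebra.intros)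

lemma cylinder_algebra_diag:
  "F \<in> cylinder_algebra M \<Longrightarrow> (\<lambda>y. F (diag y)) \<in> cylinder_algebra M"
proof (induction rule: cylinder_algebra.induct)
  case (coord f v)
  then show ?case
    using cylinder_algebra.coord[OF _ bounded_funpow[OF coord(2)], of 1 v] T_measurable
    by (simp add: diag_def)
qed (simp_all add: cylinder_algebra.intros)

lemma cylinder_algebra_diagonal:
  "F \<in> cylinder_algebra M \<Longrightarrow> (\<lambda>x. F (\<lambda>_. x)) \<in> borel_measurable M \<and> bounded ((\<lambda>x. F (\<lambda>_. x)) ` space M)"
proof (induction rule: cylinder_algebra.induct)
  case (const c)
  then show ?case by (auto intro: bounded_subset[of "{c}"])
next
  case (add F G)
  then show ?case by (auto intro: bounded_plus_comp)
next
  case (mult F G)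
  obtain A B where "\<And>x. x \<in> space M \<Longrightarrow> norm (F (\<lambda>_. x)) \<le> A" "\<And>x. x \<in> space M \<Longrightarrow> norm (G (\<lambda>_. x)) \<le> B"
    using mult by (auto simp: bounded_iff)
  then have "norm (F (\<lambda>_. x) * G (\<lambda>_. x)) \<le> A * B" if "x \<in> space M" for x
    unfolding norm_mult using that by (intro mult_mono) (fastforce intro: order_trans[OF norm_ge_zero])+
  then have "bounded ((\<lambda>x. F (\<lambda>_. x) * G (\<lambda>_. x)) ` space M)" by (auto simp: bounded_iff)
  then show ?case using mult by auto
qed auto

text \<open>Where the Host--Kra measure of dimension \<open>k\<close> exists, this is integration
  against it: the relatively independent product over the invariant factor of the diagonal action is
  the limit of averaged correlations.\<close>

primrec cube_state :: "nat \<Rightarrow> ((nat \<Rightarrow> 'a) \<Rightarrow> real) \<Rightarrow> real" where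
  "cube_state 0 F = (\<integral>x. F (\<lambda>_. x) \<partial>M)"
| "cube_state (Suc k) F = lim (\<lambda>H. (\<Sum>h=1..H. cube_state k (\<lambda>y. F (double h y))) / H)"

text \<open>Every cylinder function is a sum of products of an even and an odd part, and for each
  such product convergence is \<open>mean_ergodic\<close> one dimension below.\<close>

lemma cube_state_tendsto:
  assumes "monotone_state (cylinder_algebra M) (cube_state k) diag" and "F \<in> cylinder_algebra M"
  shows "(\<lambda>H. (\<Sum>h=1..H. cube_state k (\<lambda>y. F (double h y))) / H) \<longlonglongrightarrow> cube_state (Suc k) F"
proof -
  interpret monotone_state "cylinder_algebra M" "cube_state k" diag by fact
  \<comment> \<open>Membership of the doubled functions is carried along because additivity of
    \<open>cube_state k\<close> asks for it in the case of sums.\<close>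
  have "F \<in> split_algebra M \<Longrightarrow> F \<in> split_algebra M \<and>
    convergent (\<lambda>H. (\<Sum>h=1..H. cube_state k (\<lambda>y. F (double h y))) / H) \<and>
    (\<forall>h. (\<lambda>y. F (double h y)) \<in> cylinder_algebra M)" for F
  proof (induction rule: split_algebra.induct)
    case (tensor P Q)
    have "P (\<lambda>v. double h y (2 * v)) * Q (\<lambda>v. double h y (2 * v + 1)) = P y * Q ((diag ^^ h) y)" for h y
      by (simp add: double_def diag_funpow)
    then show ?case
      using mean_ergodic[OF tensor] mult_closed[OF tensor(1) funpow_closed[OF tensor(2)]]
        split_algebra.tensor[OF tensor] by simp
  next
    case (add F G)
    then have "convergent (\<lambda>H. (\<Sum>h=1..H. cube_state k (\<lambda>y. F (double h y))) / H +
        (\<Sum>h=1..H. cube_state k (\<lambda>y. G (double h y))) / H)"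
      by (intro convergent_add) auto
    with add show ?case
      by (simp add: monotone_state.add[OF assms(1)] sum.distrib add_divide_distrib split_algebra.add add_closed)
  qed
  then show ?thesis
    using cylinder_algebra_split[OF assms(2)] by (simp add: convergent_LIMSEQ_iff)
qed

text \<open>Additivity, homogeneity and monotonicity pass to the limit. Invariance holds term by
  term, since doubling commutes with \<open>diag\<close>.\<close>

lemma monotone_state_cube_state: "monotone_state (cylinder_algebra M) (cube_state k) diag"
proof (induction k)
  case 0
  have int: "integrable M (\<lambda>x. F (\<lambda>_. x))" if "F \<in> cylinder_algebra M" for F
    using cylinder_algebra_diagonal[OF that] by (auto intro: integrable_bounded)
  show ?case
  proof
    fix F assume "F \<in> cylinder_algebra M"
    then show "cube_state 0 (\<lambda>y. F (diag y)) = cube_state 0 F"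
      using integral_T[of "\<lambda>x. F (\<lambda>_. x)"] cylinder_algebra_diagonal[of F] by (simp add: diag_def[abs_def])
  qed (auto intro: cylinder_algebra.intros cylinder_algebra_diag int integral_mono
      Bochner_Integration.integral_add)
next
  case (Suc k)
  note lim = cube_state_tendsto[OF Suc]
  interpret k: monotone_state "cylinder_algebra M" "cube_state k" diag by fact
  note double = cylinder_algebra_double
  show ?case
  proof
    fix F G assume FG: "F \<in> cylinder_algebra M" "G \<in> cylinder_algebra M"
    show "cube_state (Suc k) (\<lambda>y. F y + G y) = cube_state (Suc k) F + cube_state (Suc k) G"
    proof (rule LIMSEQ_unique[OF lim])
      show "(\<lambda>H. (\<Sum>h=1..H. cube_state k (\<lambda>y. F (double h y) + G (double h y))) / H)
          \<longlonglongrightarrow> cube_state (Suc k) F + cube_state (Suc k) G"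
        using tendsto_add[OF lim[OF FG(1)] lim[OF FG(2)]] FG
        by (simp add: k.add double sum.distrib add_divide_distrib del: cube_state.simps)
    qed (simp add: FG cylinder_algebra.add)
    show "cube_state (Suc k) F \<le> cube_state (Suc k) G" if "\<And>y. F y \<le> G y"
      using FG that
      by (intro LIMSEQ_le[OF lim[OF FG(1)] lim[OF FG(2)]] exI allI impI divide_right_mono sum_mono k.mono double)
        auto
  next
    fix F and c :: real assume F: "F \<in> cylinder_algebra M"
    show "cube_state (Suc k) (\<lambda>y. c * F y) = c * cube_state (Suc k) F"
    proof (rule LIMSEQ_unique[OF lim])
      show "(\<lambda>H. (\<Sum>h=1..H. cube_state k (\<lambda>y. c * F (double h y))) / H) \<longlonglongrightarrow> c * cube_state (Suc k) F"
        using tendsto_mult[OF tendsto_const[of c] lim[OF F]] F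
        by (simp add: k.scale double sum_distrib_left del: cube_state.simps)
    qed (intro cylinder_algebra.mult cylinder_algebra.const F)
  next
    fix F assume F: "F \<in> cylinder_algebra M"
    show "cube_state (Suc k) (\<lambda>y. F (diag y)) = cube_state (Suc k) F"
      using k.shift[OF double[OF F]] by (simp flip: double_diag)
  qed (auto intro: cylinder_algebra.intros cylinder_algebra_diag)
qed

text \<open>For \<open>k \<ge> 1\<close> this is the power \<open>2 ^ k\<close> of the seminorm of
  order \<open>k\<close>. At \<open>k = 0\<close> the integral keeps its sign, so the recursion can
  start one step below the seminorms.\<close>

definition cube_moment :: "nat \<Rightarrow> ('a \<Rightarrow> real) \<Rightarrow> real" where
  "cube_moment k f = cube_state k (\<lambda>y. \<Prod>v<2 ^ k. f (y v))"

lemma cube_moment_0: "cube_moment 0 f = (\<integral>x. f x \<partial>M)"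
  by (simp add: cube_moment_def)

text \<open>After doubling, the entries \<open>2 * v\<close> and \<open>2 * v + 1\<close> contribute
  \<open>f\<close> at \<open>y v\<close> and at its image under \<open>T ^^ h\<close>, so each pair
  of factors merges into one factor of a lower moment.\<close>

lemma cube_moment_tendsto:
  assumes "f \<in> borel_measurable M" "bounded (f ` space M)"
  shows "(\<lambda>H. (\<Sum>h=1..H. cube_moment k (\<lambda>x. f x * f ((T ^^ h) x))) / H) \<longlonglongrightarrow> cube_moment (Suc k) f"
proof -
  have "(\<lambda>y. \<Prod>v<n. f (y v)) \<in> cylinder_algebra M" for n
    by (induction n) (simp_all add: cylinder_algebra.const cylinder_algebra.mult cylinder_algebra.coord[OF assms])
  from cube_state_tendsto[OF monotone_state_cube_state this[of "2 ^ Suc k"], of k]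
  have "(\<lambda>H. (\<Sum>h=1..H. cube_state k (\<lambda>y. \<Prod>v<2 ^ k. f (double h y (2 * v)) * f (double h y (2 * v + 1)))) / H)
      \<longlonglongrightarrow> cube_moment (Suc k) f"
    by (simp only: cube_moment_def power_Suc prod_even_odd)
  then show ?thesis by (simp add: double_def cube_moment_def del: cube_state.simps)
qed

text \<open>This joins the two recursions at their start: the seminorms begin with the absolute
  value of the integral, the moments with the integral itself. Ergodicity enters through
  \<open>birkhoff\<close>, which makes the limit of the averages constant.\<close>

lemma integral_correlation_tendsto:
  fixes f :: "'a \<Rightarrow> real"
  assumes [measurable]: "f \<in> borel_measurable M" and bdd: "bounded (f ` space M)"
  shows "(\<lambda>H. (\<Sum>h=1..H. \<integral>x. f x * f ((T ^^ h) x) \<partial>M) / H) \<longlonglongrightarrow> (\<integral>x. f x \<partial>M)\<^sup>2"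
proof -
  let ?I = "\<integral>x. f x \<partial>M"
  let ?a = "\<lambda>H x. (\<Sum>h=1..H. f ((T ^^ h) x)) / real H"
  obtain B where B: "\<And>x. x \<in> space M \<Longrightarrow> \<bar>f x\<bar> \<le> B" using bdd by (auto simp: bounded_iff)
  have int: "integrable M (\<lambda>x. f x * f ((T ^^ h) x))" for h
  proof (rule integrable_const_bound[where B = "B * B"])
    show "AE x in M. norm (f x * f ((T ^^ h) x)) \<le> B * B"
    proof (rule AE_I2)
      fix x assume "x \<in> space M"
      then have "\<bar>f x\<bar> \<le> B" "\<bar>f ((T ^^ h) x)\<bar> \<le> B" using B funpow_in_space by auto
      then show "norm (f x * f ((T ^^ h) x)) \<le> B * B"
        unfolding real_norm_def abs_mult by (intro mult_mono) auto
    qed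
  qed measurable
  have "AE x in M. (\<lambda>H. f x * ?a H x) \<longlonglongrightarrow> f x * ?I"
  proof -
    \<comment> \<open>\<open>birkhoff\<close> sums from 0 and the seminorm from 1; composing
      \<open>f\<close> with \<open>T\<close> moves the range and preserves the integral.\<close>
    have "AE x in M. (\<lambda>H. (\<Sum>j<H. f (T ((T ^^ j) x))) / real H) \<longlonglongrightarrow> (\<integral>x. f (T x) \<partial>M)"
      using bounded_funpow[OF bdd, of 1] T_measurable by (intro birkhoff) auto
    then show ?thesis
    proof eventually_elim
      case (elim x)
      have "(\<Sum>h=1..H. f ((T ^^ h) x)) = (\<Sum>j<H. f (T ((T ^^ j) x)))" for H
        by (rule sum.reindex_bij_witness[of _ Suc "\<lambda>h. h - 1"])
          (auto simp: Suc_le_eq gr0_conv_Suc)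
      then show ?case using elim integral_T[OF assms(1)] by (intro tendsto_mult tendsto_const) simp
    qed
  qed
  moreover have "norm (f x * ?a H x) \<le> B * B" if "x \<in> space M" for H x
  proof -
    have "\<bar>\<Sum>h=1..H. f ((T ^^ h) x)\<bar> \<le> (\<Sum>h=1..H. B)"
      using that by (intro order_trans[OF sum_abs] sum_mono B funpow_in_space)
    moreover have "B \<ge> 0" using B[OF that] by linarith
    ultimately have "\<bar>?a H x\<bar> \<le> B" by (cases "H = 0") (auto simp: field_simps)
    then show ?thesis unfolding real_norm_def abs_mult using B[OF that] by (intro mult_mono) auto
  qed
  ultimately have lim: "(\<lambda>H. \<integral>x. f x * ?a H x \<partial>M) \<longlonglongrightarrow> (\<integral>x. f x * ?I \<partial>M)"
    by (intro integral_dominated_convergence[where w = "\<lambda>_. B * B"]) auto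
  have eq: "(\<integral>x. f x * ?a H x \<partial>M) = (\<Sum>h=1..H. \<integral>x. f x * f ((T ^^ h) x) \<partial>M) / H" for H
  proof -
    have "(\<integral>x. f x * ?a H x \<partial>M) = (\<integral>x. (\<Sum>h=1..H. f x * f ((T ^^ h) x)) / H \<partial>M)"
      by (simp add: sum_distrib_left)
    also have "\<dots> = (\<Sum>h=1..H. \<integral>x. f x * f ((T ^^ h) x) \<partial>M) / H"
      using int by simp
    finally show ?thesis .
  qed
  show ?thesis using lim unfolding eq by (simp add: power2_eq_square)
qed

lemma bounded_measurable_diff:
  fixes f :: "'a \<Rightarrow> real"
  assumes [measurable]: "f \<in> borel_measurable M" and bdd: "bounded (f ` space M)"
  shows "(\<lambda>x. f x * f ((T ^^ h) x)) \<in> borel_measurable M"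
    and "bounded ((\<lambda>x. f x * f ((T ^^ h) x)) ` space M)"
proof -
  obtain B where B: "\<And>x. x \<in> space M \<Longrightarrow> \<bar>f x\<bar> \<le> B" using bdd by (auto simp: bounded_iff)
  have "norm (f x * f ((T ^^ h) x)) \<le> B * B" if "x \<in> space M" for x
  proof -
    have "\<bar>f x\<bar> \<le> B" "\<bar>f ((T ^^ h) x)\<bar> \<le> B" using that B funpow_in_space by auto
    then show ?thesis unfolding real_norm_def abs_mult by (intro mult_mono) auto
  qed
  then show "bounded ((\<lambda>x. f x * f ((T ^^ h) x)) ` space M)" by (auto simp: bounded_iff)
qed measurable

text \<open>Here the \<open>lim\<close> of the definition becomes an actual limit. It is nonnegative
  as a limit of means of even powers, so taking the power undoes the root.\<close>

lemma hk_seminorm_power: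
  assumes "f \<in> borel_measurable M" "bounded (f ` space M)"
  shows "hk_seminorm M T (Suc k) f ^ 2 ^ Suc k = cube_moment (Suc k) f"
  using assms
proof (induction k arbitrary: f)
  case 0
  have "cube_moment (Suc 0) f = (\<integral>x. f x \<partial>M)\<^sup>2"
    using LIMSEQ_unique[OF cube_moment_tendsto[OF 0, of 0]] integral_correlation_tendsto[OF 0]
    by (simp add: cube_moment_0)
  then show ?case by simp
next
  case (Suc k)
  let ?S = "\<lambda>H. (\<Sum>h=1..H. hk_seminorm M T (Suc k) (\<lambda>x. f x * f ((T ^^ h) x)) ^ 2 ^ Suc k) / real H"
  have lim: "?S \<longlonglongrightarrow> cube_moment (Suc (Suc k)) f"
    using cube_moment_tendsto[OF Suc.prems, of "Suc k"] Suc.IH[OF bounded_measurable_diff[OF Suc.prems]] by simp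
  have "0 \<le> cube_moment (Suc (Suc k)) f"
    by (rule LIMSEQ_le_const[OF lim]) (auto intro!: exI[of _ 0] divide_nonneg_nonneg sum_nonneg zero_le_even_power)
  moreover have "hk_seminorm M T (Suc (Suc k)) f = root (2 ^ (k + 2)) (cube_moment (Suc (Suc k)) f)"
    using limI[OF lim] by simp
  ultimately show ?case by simp
qed

end

section \<open>Averages over cubes of sequences\<close>

definition grid :: "nat \<Rightarrow> nat \<Rightarrow> nat list set" where
  "grid k N = {xs. set xs \<subseteq> {..<N} \<and> length xs = k}"

lemma finite_grid [simp]: "finite (grid k N)"
  unfolding grid_def by (rule finite_lists_length_eq) simp

lemma card_grid [simp]: "card (grid k N) = N ^ k"
  unfolding grid_def using card_lists_length_eq[of "{..<N}" k] by simp

lemma grid_0 [simp]: "grid 0 N = {[]}"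
  by (auto simp: grid_def)

lemma sum_grid_Suc: "(\<Sum>xs\<in>grid (Suc k) N. F xs) = (\<Sum>i<N. \<Sum>xs\<in>grid k N. F (i # xs))"
proof -
  have "(\<Sum>xs\<in>grid (Suc k) N. F xs) = (\<Sum>(i, xs)\<in>{..<N} \<times> grid k N. F (i # xs))"
    by (rule sum.reindex_bij_witness[of _ "\<lambda>(i, xs). i # xs" "\<lambda>xs. (hd xs, tl xs)"])
      (auto simp: grid_def length_Suc_conv)
  then show ?thesis by (simp add: sum.cartesian_product)
qed

text \<open>
  Functions \<open>(m, xs) \<mapsto> \<Prod>\<^sub>\<epsilon> a\<^sub>\<epsilon>(m + \<epsilon> \<cdot> xs)\<close> on cubes for which only one factor \<open>c\<close> is
  remembered: each coordinate splits the cube into two faces, and nothing but the bound \<open>1\<close> is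
  kept of the face that does not carry \<open>c\<close>.
\<close>

inductive cube_fun :: "(nat \<Rightarrow> complex) \<Rightarrow> nat \<Rightarrow> (nat \<Rightarrow> nat list \<Rightarrow> complex) \<Rightarrow> bool" for c where
  corner: "(\<And>m. F m [] = c m) \<Longrightarrow> cube_fun c 0 F"
| lower: "cube_fun c k G \<Longrightarrow> (\<And>m xs. norm (G' m xs) \<le> 1) \<Longrightarrow>
    (\<And>m i xs. F m (i # xs) = G m xs * G' (m + i) xs) \<Longrightarrow> cube_fun c (Suc k) F"
| upper: "cube_fun c k G \<Longrightarrow> (\<And>m xs. norm (G' m xs) \<le> 1) \<Longrightarrow>
    (\<And>m i xs. F m (i # xs) = G' m xs * G (m + i) xs) \<Longrightarrow> cube_fun c (Suc k) F"

lemma cube_fun_norm_le_1: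
  assumes "cube_fun c k F" "\<And>m. norm (c m) \<le> 1" "length xs = k"
  shows "norm (F m xs) \<le> 1"
  using assms
proof (induction arbitrary: m xs rule: cube_fun.induct)
  case (lower k G G' F)
  then show ?case by (cases xs) (auto simp: norm_mult intro!: mult_le_one)
next
  case (upper k G G' F)
  then show ?case by (cases xs) (auto simp: norm_mult intro!: mult_le_one)
qed auto

text \<open>A shift of the base point acts on each face separately, so multiplication by the
  conjugate respects the face structure and only the remembered corner changes.\<close>

lemma cube_fun_diff:
  "cube_fun c k F \<Longrightarrow> cube_fun (\<lambda>m. c (m + h) * cnj (c m)) k (\<lambda>m xs. F (m + h) xs * cnj (F m xs))"
proof (induction rule: cube_fun.induct)
  case (corner F)
  then show ?case by (intro cube_fun.corner) auto
next
  case (lower k G G' F)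
  show ?case
    by (rule cube_fun.lower[OF lower.IH, of "\<lambda>m xs. G' (m + h) xs * cnj (G' m xs)"])
      (use lower in \<open>auto simp: norm_mult add_ac intro!: mult_le_one\<close>)
next
  case (upper k G G' F)
  show ?case
    by (rule cube_fun.upper[OF upper.IH, of "\<lambda>m xs. G' (m + h) xs * cnj (G' m xs)"])
      (use upper in \<open>auto simp: norm_mult add_ac intro!: mult_le_one\<close>)
qed

section \<open>Van der Corput's inequality\<close>

lemma sum_abs_diff_le:
  fixes x :: "nat \<Rightarrow> real"
  assumes "r < H" "\<And>h. 0 \<le> x h"
  shows "(\<Sum>s<H. x (if r \<le> s then s - r else r - s)) \<le> 2 * (\<Sum>h<H. x h)"
proof -
  have "(\<Sum>s<H. x (if r \<le> s then s - r else r - s)) =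
      (\<Sum>s\<in>{r..<H} \<union> {..<r}. x (if r \<le> s then s - r else r - s))"
    using assms(1) by (intro sum.cong) auto
  also have "\<dots> = (\<Sum>s\<in>{r..<H}. x (s - r)) + (\<Sum>s<r. x (r - s))"
    by (subst sum.union_disjoint) auto
  also have "(\<Sum>s\<in>{r..<H}. x (s - r)) = sum x ((\<lambda>s. s - r) ` {r..<H})"
    by (subst sum.reindex) (auto simp: inj_on_def)
  also have "\<dots> \<le> (\<Sum>h<H. x h)" using assms by (intro sum_mono2) auto
  also have "(\<Sum>s<r. x (r - s)) = sum x ((\<lambda>s. r - s) ` {..<r})"
    by (subst sum.reindex) (auto simp: inj_on_def)
  also have "\<dots> \<le> (\<Sum>h<H. x h)" using assms by (intro sum_mono2) auto
  finally show ?thesis by simp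
qed

lemma norm_sum_squared_le:
  fixes f :: "'b \<Rightarrow> complex"
  shows "(norm (\<Sum>i\<in>I. f i))\<^sup>2 \<le> card I * (\<Sum>i\<in>I. (norm (f i))\<^sup>2)"
proof -
  have "(norm (\<Sum>i\<in>I. f i))\<^sup>2 \<le> (\<Sum>i\<in>I. norm (f i))\<^sup>2" by (intro power_mono norm_sum) auto
  also have "\<dots> \<le> card I * (\<Sum>i\<in>I. (norm (f i))\<^sup>2)"
    using sum_squared_le_sum_of_squares[of "\<lambda>i. norm (f i)" I] by (simp add: mult.commute)
  finally show ?thesis .
qed

text \<open>All translates of \<open>u i\<close> have the same sum; adding \<open>H\<close> of them
  before Cauchy--Schwarz leaves correlations governed by the difference of two shifts. On the right
  the norm stands outside the sum over \<open>i\<close>, so cancellation between different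
  \<open>i\<close> remains available to the induction.\<close>

lemma van_der_corput:
  fixes u :: "'b \<Rightarrow> nat \<Rightarrow> complex"
  assumes "finite I"
  shows "H * (\<Sum>i\<in>I. (norm (\<Sum>t\<in>{b..<b+L}. u i t))\<^sup>2) \<le>
    2 * (L + H) * (\<Sum>h<H. norm (\<Sum>i\<in>I. \<Sum>t\<in>{b..<b+(L-h)}. u i (t + h) * cnj (u i t)))"
proof (cases "H = 0")
  case False
  \<comment> \<open>\<open>v i r\<close> is \<open>u i\<close> cut off to the interval and moved by
    \<open>r\<close>; the window \<open>W\<close> of length \<open>L + H\<close> contains the
    support of every translate with \<open>r < H\<close>.\<close>
  define v where "v i r t = (if b + r \<le> t \<and> t < b + r + L then u i (t - r) else 0)" for i r t
  define W where "W = {b..<b+L+H}"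
  define x where "x h = norm (\<Sum>i\<in>I. \<Sum>t\<in>{b..<b+(L-h)}. u i (t + h) * cnj (u i t))" for h
  define X where "X r s = (\<Sum>i\<in>I. \<Sum>t\<in>W. v i r t * cnj (v i s t))" for r s
  have sum_v: "(\<Sum>t\<in>W. v i r t) = (\<Sum>t\<in>{b..<b+L}. u i t)" if "r < H" for i r
  proof -
    have "(\<Sum>t\<in>W. v i r t) = (\<Sum>t\<in>{b+r..<(b+L)+r}. u i (t - r))"
      unfolding v_def using that by (intro sum.mono_neutral_cong_right) (auto simp: W_def)
    also have "\<dots> = (\<Sum>t\<in>{b..<b+L}. u i t)" by (simp only: sum.shift_bounds_nat_ivl add_diff_cancel_right')
    finally show ?thesis .
  qed
  have corr: "(\<Sum>t\<in>W. v i r t * cnj (v i s t)) = (\<Sum>t\<in>{b..<b+(L-(s-r))}. u i (t + (s - r)) * cnj (u i t))"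
    if "r \<le> s" "s < H" for i r s
  proof (cases "s - r \<le> L")
    case True
    have "(\<Sum>t\<in>W. v i r t * cnj (v i s t)) = (\<Sum>t\<in>{b+s..<(b+(L-(s-r)))+s}. u i (t - r) * cnj (u i (t - s)))"
      unfolding v_def using that True by (intro sum.mono_neutral_cong_right) (auto simp: W_def)
    also have "\<dots> = (\<Sum>t\<in>{b..<b+(L-(s-r))}. u i (t + (s - r)) * cnj (u i t))"
      unfolding sum.shift_bounds_nat_ivl using that by (intro sum.cong) auto
    finally show ?thesis .
  next
    case False
    then have "(\<Sum>t\<in>W. v i r t * cnj (v i s t)) = 0" by (intro sum.neutral) (auto simp: v_def)
    then show ?thesis using False by simp
  qed
  have X_le: "norm (X r s) = x (s - r)" if "r \<le> s" "s < H" for r s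
    unfolding X_def x_def using corr[OF that] by simp
  have "norm (X r s) = norm (X s r)" for r s
  proof -
    have "X r s = cnj (X s r)" unfolding X_def by (simp add: mult.commute)
    then show ?thesis by simp
  qed
  then have X_norm: "norm (X r s) = x (if r \<le> s then s - r else r - s)" if "r < H" "s < H" for r s
    using X_le[of r s] X_le[of s r] that by (auto simp: not_le)
  have "H\<^sup>2 * (\<Sum>i\<in>I. (norm (\<Sum>t\<in>{b..<b+L}. u i t))\<^sup>2) =
      (\<Sum>i\<in>I. (norm (\<Sum>t\<in>W. \<Sum>r<H. v i r t))\<^sup>2)"
    unfolding sum_distrib_left
    by (intro sum.cong refl, subst sum.swap) (simp add: sum_v norm_mult power_mult_distrib)
  also have "\<dots> \<le> (\<Sum>i\<in>I. (L + H) * (\<Sum>t\<in>W. (norm (\<Sum>r<H. v i r t))\<^sup>2))"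
    using norm_sum_squared_le[of _ W] by (intro sum_mono) (simp add: W_def)
  also have "\<dots> = (L + H) * (\<Sum>i\<in>I. \<Sum>t\<in>W. (norm (\<Sum>r<H. v i r t))\<^sup>2)"
    by (simp add: sum_distrib_left)
  finally have 1: "H\<^sup>2 * (\<Sum>i\<in>I. (norm (\<Sum>t\<in>{b..<b+L}. u i t))\<^sup>2) \<le>
      (L + H) * (\<Sum>i\<in>I. \<Sum>t\<in>W. (norm (\<Sum>r<H. v i r t))\<^sup>2)" .
  have "(\<Sum>i\<in>I. \<Sum>t\<in>W. (norm (\<Sum>r<H. v i r t))\<^sup>2) \<le> (\<Sum>r<H. \<Sum>s<H. norm (X r s))"
  proof -
    \<comment> \<open>As an identity of complex numbers the expanded square can be regrouped with
      \<open>i\<close> and \<open>t\<close> innermost before any norm is taken.\<close>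
    have "complex_of_real (\<Sum>i\<in>I. \<Sum>t\<in>W. (norm (\<Sum>r<H. v i r t))\<^sup>2) =
        (\<Sum>i\<in>I. \<Sum>t\<in>W. \<Sum>r<H. \<Sum>s<H. v i r t * cnj (v i s t))"
      by (simp only: of_real_sum complex_norm_square[unfolded of_real_power[symmetric]] cnj_sum sum_product)
    also have "\<dots> = (\<Sum>i\<in>I. \<Sum>r<H. \<Sum>t\<in>W. \<Sum>s<H. v i r t * cnj (v i s t))"
      by (intro sum.cong refl sum.swap)
    also have "\<dots> = (\<Sum>r<H. \<Sum>i\<in>I. \<Sum>s<H. \<Sum>t\<in>W. v i r t * cnj (v i s t))"
      by (subst sum.swap) (intro sum.cong refl sum.swap)
    also have "\<dots> = (\<Sum>r<H. \<Sum>s<H. X r s)"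
      unfolding X_def by (intro sum.cong refl sum.swap)
    finally have "norm (complex_of_real (\<Sum>i\<in>I. \<Sum>t\<in>W. (norm (\<Sum>r<H. v i r t))\<^sup>2)) = norm (\<Sum>r<H. \<Sum>s<H. X r s)"
      by (rule arg_cong)
    also have "\<dots> \<le> (\<Sum>r<H. \<Sum>s<H. norm (X r s))"
      by (intro order_trans[OF norm_sum] sum_mono norm_sum)
    finally show ?thesis
      unfolding norm_of_real by linarith
  qed
  also have "(\<Sum>r<H. \<Sum>s<H. norm (X r s)) \<le> (\<Sum>r<H. 2 * (\<Sum>h<H. x h))"
  proof (rule sum_mono)
    fix r assume "r \<in> {..<H}"
    then have "(\<Sum>s<H. norm (X r s)) = (\<Sum>s<H. x (if r \<le> s then s - r else r - s))"
      by (intro sum.cong refl) (simp only: X_norm lessThan_iff)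
    also have "\<dots> \<le> 2 * (\<Sum>h<H. x h)"
      using \<open>r \<in> {..<H}\<close> by (intro sum_abs_diff_le) (auto simp: x_def)
    finally show "(\<Sum>s<H. norm (X r s)) \<le> 2 * (\<Sum>h<H. x h)" .
  qed
  finally have 2: "(\<Sum>i\<in>I. \<Sum>t\<in>W. (norm (\<Sum>r<H. v i r t))\<^sup>2) \<le> H * (2 * (\<Sum>h<H. x h))"
    by simp
  have "real H * (H * (\<Sum>i\<in>I. (norm (\<Sum>t\<in>{b..<b+L}. u i t))\<^sup>2)) \<le> (L + H) * (H * (2 * (\<Sum>h<H. x h)))"
    using order_trans[OF 1 mult_left_mono[OF 2]] by (simp add: power2_eq_square mult.assoc)
  then have "real H * (H * (\<Sum>i\<in>I. (norm (\<Sum>t\<in>{b..<b+L}. u i t))\<^sup>2)) \<le> real H * (2 * (L + H) * (\<Sum>h<H. x h))"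
    by (simp add: algebra_simps)
  then show ?thesis unfolding x_def using False by (subst (asm) mult_le_cancel_left_pos) auto
qed simp

section \<open>Induction on the dimension of the cube\<close>

text \<open>
  The function \<open>g\<close> plays the role of the face on which the base point \<open>t\<close> does not occur.
\<close>

definition cube_sum :: "nat \<Rightarrow> nat \<Rightarrow> (nat list \<Rightarrow> complex) \<Rightarrow> nat \<Rightarrow> nat \<Rightarrow> (nat \<Rightarrow> nat list \<Rightarrow> complex) \<Rightarrow> complex" where
  "cube_sum k N g b L F = (\<Sum>xs\<in>grid k N. g xs * (\<Sum>t\<in>{b..<b+L}. F t xs))"

definition cube_bound :: "(nat \<Rightarrow> complex) \<Rightarrow> nat \<Rightarrow> real \<Rightarrow> bool" where
  "cube_bound c k \<beta> \<longleftrightarrow> (\<forall>B::nat. \<forall>\<delta>>0. \<forall>\<^sub>F N in sequentially. \<forall>F g b L.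
     cube_fun c k F \<longrightarrow> (\<forall>xs. norm (g xs) \<le> 1) \<longrightarrow> b \<le> B * N \<longrightarrow> L \<le> N \<longrightarrow>
     (norm (cube_sum k N g b L F) / N ^ Suc k) ^ (2 ^ Suc k) \<le> \<beta> + \<delta>)"

text \<open>With \<open>s = t + i\<close> held fixed, \<open>t\<close> runs through an interval.
  Truncated subtraction covers small \<open>s\<close> and empty intervals; the end is written as
  start plus length to fit \<open>cube_sum\<close>.\<close>

lemma sum_lower_face_swap:
  fixes f :: "nat \<Rightarrow> nat \<Rightarrow> complex"
  shows "(\<Sum>t\<in>{b..<b+L}. \<Sum>i<N. f t (t + i)) =
    (\<Sum>s\<in>{b..<b+L+N}. \<Sum>t\<in>{max b (s+1-N)..<max b (s+1-N) + (min (b+L) (s+1) - max b (s+1-N))}. f t s)"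
proof -
  have "(\<Sum>i<N. f t (t + i)) = (\<Sum>s\<in>{b..<b+L+N}. if t \<le> s \<and> s < t + N then f t s else 0)"
    if "t \<in> {b..<b+L}" for t
  proof -
    have "(\<Sum>i<N. f t (t + i)) = (\<Sum>s\<in>{0+t..<N+t}. f t s)"
      unfolding sum.shift_bounds_nat_ivl by (simp add: add.commute atLeast0LessThan)
    also have "\<dots> = (\<Sum>s\<in>{b..<b+L+N}. if t \<le> s \<and> s < t + N then f t s else 0)"
      using that by (intro sum.mono_neutral_cong_left) auto
    finally show ?thesis .
  qed
  then have "(\<Sum>t\<in>{b..<b+L}. \<Sum>i<N. f t (t + i)) =
      (\<Sum>s\<in>{b..<b+L+N}. \<Sum>t\<in>{b..<b+L}. if t \<le> s \<and> s < t + N then f t s else 0)"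
    by (subst sum.swap) simp
  also have "\<dots> = (\<Sum>s\<in>{b..<b+L+N}. \<Sum>t\<in>{max b (s+1-N)..<max b (s+1-N) + (min (b+L) (s+1) - max b (s+1-N))}. f t s)"
    by (intro sum.cong refl sum.mono_neutral_cong_right) auto
  finally show ?thesis .
qed

text \<open>The face without \<open>c\<close> depends on only one of \<open>t\<close> and
  \<open>t + i\<close>. With that variable frozen it is a weight for the sum over the other; there
  are at most \<open>L + N\<close> slices, hence the factor 2.\<close>

lemma cube_sum_slices:
  assumes "cube_fun c (Suc k) F" "b \<le> B * N" "L \<le> N" "0 \<le> \<gamma>"
    and slice: "\<And>G g b L. cube_fun c k G \<Longrightarrow> (\<forall>xs. norm (g xs) \<le> 1) \<Longrightarrow> b \<le> (B + 1) * N \<Longrightarrow> L \<le> N \<Longrightarrow>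
      norm (cube_sum k N g b L G) \<le> \<gamma>"
  shows "norm (\<Sum>xs\<in>grid (Suc k) N. \<Sum>t\<in>{b..<b+L}. F t xs) \<le> 2 * real N * \<gamma>"
  using assms(1)
proof cases
  case (lower G G')
  let ?b = "\<lambda>s. max b (s + 1 - N)"
  let ?L = "\<lambda>s. min (b + L) (s + 1) - ?b s"
  have "(\<Sum>xs\<in>grid (Suc k) N. \<Sum>t\<in>{b..<b+L}. F t xs) =
      (\<Sum>xs\<in>grid k N. \<Sum>t\<in>{b..<b+L}. \<Sum>i<N. G t xs * G' (t + i) xs)"
    unfolding sum_grid_Suc lower
    by (subst sum.swap) (intro sum.cong refl sum.swap)
  also have "\<dots> = (\<Sum>xs\<in>grid k N. \<Sum>s\<in>{b..<b+L+N}. \<Sum>t\<in>{?b s..<?b s + ?L s}. G t xs * G' s xs)"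
    by (simp only: sum_lower_face_swap[where f = "\<lambda>t s. G t _ * G' s _"])
  also have "\<dots> = (\<Sum>s\<in>{b..<b+L+N}. cube_sum k N (G' s) (?b s) (?L s) G)"
    unfolding cube_sum_def by (subst sum.swap) (simp add: sum_distrib_left mult.commute)
  also have "norm \<dots> \<le> (\<Sum>s\<in>{b..<b+L+N}. \<gamma>)"
    using assms(2,3) lower by (intro order_trans[OF norm_sum] sum_mono slice) auto
  also have "\<dots> \<le> 2 * real N * \<gamma>" using assms(3,4) by (auto intro!: mult_right_mono)
  finally show ?thesis by simp
next
  case (upper G G')
  have "(\<Sum>xs\<in>grid (Suc k) N. \<Sum>t\<in>{b..<b+L}. F t xs) =
      (\<Sum>xs\<in>grid k N. \<Sum>t\<in>{b..<b+L}. \<Sum>i<N. G' t xs * G (t + i) xs)"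
    unfolding sum_grid_Suc upper
    by (subst sum.swap) (intro sum.cong refl sum.swap)
  also have "\<dots> = (\<Sum>xs\<in>grid k N. \<Sum>t\<in>{b..<b+L}. \<Sum>s\<in>{0+t..<N+t}. G' t xs * G s xs)"
    unfolding sum.shift_bounds_nat_ivl by (simp add: add.commute atLeast0LessThan)
  also have "\<dots> = (\<Sum>t\<in>{b..<b+L}. cube_sum k N (G' t) t N G)"
    unfolding cube_sum_def by (subst sum.swap) (simp add: sum_distrib_left add.commute)
  also have "norm \<dots> \<le> (\<Sum>t\<in>{b..<b+L}. \<gamma>)"
    using assms(2,3) upper by (intro order_trans[OF norm_sum] sum_mono slice) auto
  also have "\<dots> \<le> 2 * real N * \<gamma>" using assms(3,4) by (auto intro!: mult_right_mono)
  finally show ?thesis by simp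
qed

lemma average_power_le:
  fixes \<gamma> :: "nat \<Rightarrow> real"
  assumes "\<And>h. 0 \<le> \<gamma> h" "H > 0"
  shows "((\<Sum>h<H. \<gamma> h) / H) ^ (2 ^ k) \<le> (\<Sum>h<H. \<gamma> h ^ (2 ^ k)) / H"
proof (cases k)
  case (Suc j)
  have "convex_on (UNIV :: real set) (\<lambda>x. x ^ (2 ^ k))"
    using Suc by (intro convex_power_even) auto
  from convex_on_sum[OF _ _ this, of "{..<H}" "\<lambda>_. 1 / H" \<gamma>]
  show ?thesis using \<open>H > 0\<close> by (simp add: sum_divide_distrib lessThan_empty_iff)
qed simp

text \<open>Cauchy--Schwarz disposes of \<open>g\<close>, van der Corput and slicing lead to
  dimension \<open>k\<close>, and Jensen passes from the mean of the bounds to the mean of their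
  powers. The base 8 collects a factor 2 from van der Corput, one from
  \<open>L + Suc H \<le> 2 * N\<close>, and one from the slices.\<close>

lemma cube_bound_step:
  assumes c: "\<And>m. norm (c m) \<le> 1"
    and diff: "\<And>h. h \<ge> 1 \<Longrightarrow> cube_bound (\<lambda>m. c (m + h) * cnj (c m)) k (\<beta> h)"
    and nonneg: "\<And>h. 0 \<le> \<beta> h"
    and lim: "(\<lambda>H. (\<Sum>h=1..H. \<beta> h) / H) \<longlonglongrightarrow> \<beta>'"
  shows "cube_bound c (Suc k) (8 ^ (2 ^ Suc k) * \<beta>')"
  unfolding cube_bound_def
proof (intro allI impI)
  fix B :: nat and \<delta> :: real assume "\<delta> > 0"
  define p :: nat where "p = 2 ^ Suc k"
  \<comment> \<open>Three errors of size \<open>\<eta>\<close> will occur: the mean over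
    \<open>h\<close> against its limit, the term \<open>h = 0\<close>, and the slack in each
    \<open>cube_bound\<close>.\<close>
  define \<eta> where "\<eta> = \<delta> / (3 * 8 ^ p)"
  have p: "p > 0" by (simp add: p_def)
  have \<eta>: "\<eta> > 0" "3 * 8 ^ p * \<eta> = \<delta>" using \<open>\<delta> > 0\<close> by (simp_all add: \<eta>_def)
  have "eventually (\<lambda>H. (\<Sum>h=1..H. \<beta> h) / H < \<beta>' + \<eta>) sequentially"
    using \<eta> by (intro order_tendstoD(2)[OF lim]) simp
  moreover have "eventually (\<lambda>H::nat. 1 / real H < \<eta>) sequentially"
    using \<eta> by (intro order_tendstoD(2)[OF lim_1_over_n]) simp
  moreover note eventually_gt_at_top[of "0::nat"]
  ultimately have "eventually (\<lambda>H. (\<Sum>h=1..H. \<beta> h) / H < \<beta>' + \<eta> \<and> 1 / real H < \<eta> \<and> 0 < H) sequentially"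
    by (simp add: eventually_conj_iff)
  then obtain H where H: "(\<Sum>h=1..H. \<beta> h) / H < \<beta>' + \<eta>" "1 / real H < \<eta>" "0 < H"
    using eventually_happens[of _ sequentially] by auto
  \<comment> \<open>The correlation of shift 0 has only the trivial bound 1, which costs at most
    \<open>1 / H\<close> in the mean.\<close>
  define \<gamma> where "\<gamma> h = (if h = 0 then 1 else root p (\<beta> h + \<eta>))" for h
  have \<gamma>_nonneg: "0 \<le> \<gamma> h" for h using nonneg[of h] \<eta> by (simp add: \<gamma>_def p)
  have \<gamma>_power: "\<gamma> h ^ p = \<beta> h + \<eta>" if "h \<ge> 1" for h
    using that nonneg[of h] \<eta> by (simp add: \<gamma>_def p)
  have avg: "((\<Sum>h<Suc H. \<gamma> h) / Suc H) ^ p \<le> \<beta>' + 3 * \<eta>"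
  proof -
    have "((\<Sum>h<Suc H. \<gamma> h) / Suc H) ^ p \<le> (\<Sum>h<Suc H. \<gamma> h ^ p) / Suc H"
      unfolding p_def using \<gamma>_nonneg by (intro average_power_le) auto
    also have "(\<Sum>h<Suc H. \<gamma> h ^ p) = 1 + (\<Sum>h=1..H. \<beta> h + \<eta>)"
    proof -
      have "{..<Suc H} = insert 0 {1..H}" by auto
      then have "(\<Sum>h<Suc H. \<gamma> h ^ p) = \<gamma> 0 ^ p + (\<Sum>h=1..H. \<gamma> h ^ p)" by simp
      also have "(\<Sum>h=1..H. \<gamma> h ^ p) = (\<Sum>h=1..H. \<beta> h + \<eta>)"
        by (intro sum.cong refl \<gamma>_power) auto
      finally show ?thesis by (simp add: \<gamma>_def)
    qed
    also have "(1 + (\<Sum>h=1..H. \<beta> h + \<eta>)) / Suc H \<le> (1 + (\<Sum>h=1..H. \<beta> h + \<eta>)) / H"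
      using H(3) nonneg \<eta> by (intro divide_left_mono add_nonneg_nonneg sum_nonneg) auto
    also have "\<dots> = 1 / H + (\<Sum>h=1..H. \<beta> h) / H + \<eta>"
      using H(3) by (simp add: sum.distrib field_simps)
    also have "\<dots> \<le> \<beta>' + 3 * \<eta>" using H by simp
    finally show ?thesis .
  qed
  have "eventually (\<lambda>N. \<forall>h\<in>{1..H}. \<forall>F g b L. cube_fun (\<lambda>m. c (m + h) * cnj (c m)) k F \<longrightarrow>
      (\<forall>xs. norm (g xs) \<le> 1) \<longrightarrow> b \<le> (B + 1) * N \<longrightarrow> L \<le> N \<longrightarrow>
      (norm (cube_sum k N g b L F) / N ^ Suc k) ^ p \<le> \<beta> h + \<eta>) sequentially"
    unfolding p_def using diff \<eta>(1) unfolding cube_bound_def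
    by (intro eventually_ball_finite finite_atLeastAtMost ballI) (simp only: atLeastAtMost_iff)
  then show "\<forall>\<^sub>F N in sequentially. \<forall>F g b L. cube_fun c (Suc k) F \<longrightarrow> (\<forall>xs. norm (g xs) \<le> 1) \<longrightarrow>
      b \<le> B * N \<longrightarrow> L \<le> N \<longrightarrow>
      (norm (cube_sum (Suc k) N g b L F) / N ^ Suc (Suc k)) ^ (2 ^ Suc (Suc k)) \<le> 8 ^ (2 ^ Suc k) * \<beta>' + \<delta>"
    using eventually_ge_at_top[of "Suc H"]
  proof eventually_elim
    case (elim N)
    show ?case
    proof (intro allI impI)
      fix F and g :: "nat list \<Rightarrow> complex" and b L
      assume F: "cube_fun c (Suc k) F" and g: "\<forall>xs. norm (g xs) \<le> 1" and b: "b \<le> B * N" and L: "L \<le> N"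
      have N: "N > 0" using elim by simp
      define S where "S = cube_sum (Suc k) N g b L F"
      define x where "x h = norm (\<Sum>xs\<in>grid (Suc k) N. \<Sum>t\<in>{b..<b+(L-h)}. F (t + h) xs * cnj (F t xs))" for h
      have F_le: "norm (F m xs) \<le> 1" if "xs \<in> grid (Suc k) N" for m xs
        using cube_fun_norm_le_1[OF F c] that by (auto simp: grid_def)
      have x_le: "x h \<le> 2 * real N * (\<gamma> h * N ^ Suc k)" if "h < Suc H" for h
      proof (cases "h = 0")
        case True
        have "x h \<le> (\<Sum>xs\<in>grid (Suc k) N. \<Sum>t\<in>{b..<b+(L-h)}. 1)"
          unfolding x_def using F_le
          by (intro order_trans[OF norm_sum] sum_mono) (auto simp: norm_mult intro!: mult_le_one)
        also have "\<dots> = N ^ Suc k * L" using True by simp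
        also have "\<dots> \<le> real (N ^ Suc k) * real N" using L by (simp add: mult_left_mono)
        also have "\<dots> \<le> 2 * real N * (\<gamma> h * N ^ Suc k)" using True by (simp add: \<gamma>_def)
        finally show ?thesis .
      next
        case False
        show ?thesis
          unfolding x_def
        proof (rule cube_sum_slices[OF cube_fun_diff[OF F, of h] b])
          show "L - h \<le> N" using L by simp
          show "0 \<le> \<gamma> h * N ^ Suc k" using \<gamma>_nonneg by simp
          fix G and g :: "nat list \<Rightarrow> complex" and b L
          assume *: "cube_fun (\<lambda>m. c (m + h) * cnj (c m)) k G" "\<forall>xs. norm (g xs) \<le> 1"
            "b \<le> (B + 1) * N" "L \<le> N"
          have "(norm (cube_sum k N g b L G) / N ^ Suc k) ^ p \<le> \<gamma> h ^ p"
            using elim(1) False that * \<gamma>_power[of h] by auto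
          then have "norm (cube_sum k N g b L G) / N ^ Suc k \<le> \<gamma> h"
            using p \<gamma>_nonneg by (subst (asm) power_mono_iff) auto
          then show "norm (cube_sum k N g b L G) \<le> \<gamma> h * N ^ Suc k"
            using N by (simp add: field_simps)
        qed
      qed
      have "(norm S)\<^sup>2 \<le> real (N ^ Suc k) * (\<Sum>xs\<in>grid (Suc k) N. (norm (g xs * (\<Sum>t\<in>{b..<b+L}. F t xs)))\<^sup>2)"
        unfolding S_def cube_sum_def using norm_sum_squared_le[of _ "grid (Suc k) N"] by simp
      also have "\<dots> \<le> real (N ^ Suc k) * (\<Sum>xs\<in>grid (Suc k) N. (norm (\<Sum>t\<in>{b..<b+L}. F t xs))\<^sup>2)"
        using g by (intro mult_left_mono sum_mono power_mono) (auto simp: norm_mult mult_left_le_one_le)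
      finally have "Suc H * (norm S)\<^sup>2 \<le>
          Suc H * (real (N ^ Suc k) * (\<Sum>xs\<in>grid (Suc k) N. (norm (\<Sum>t\<in>{b..<b+L}. F t xs))\<^sup>2))"
        by (intro mult_left_mono) auto
      also have "\<dots> = real (N ^ Suc k) * (Suc H * (\<Sum>xs\<in>grid (Suc k) N. (norm (\<Sum>t\<in>{b..<b+L}. F t xs))\<^sup>2))"
        by (simp add: mult_ac)
      also have "\<dots> \<le> real (N ^ Suc k) * (2 * (real L + real (Suc H)) * (\<Sum>h<Suc H. x h))"
        unfolding x_def
        using van_der_corput[OF finite_grid, where u = "\<lambda>xs t. F t xs" and H = "Suc H"]
        by (intro mult_left_mono) (simp_all del: sum.lessThan_Suc of_nat_Suc)
      also have "\<dots> \<le> real (N ^ Suc k) * ((4 * real N) * (\<Sum>h<Suc H. 2 * real N * (\<gamma> h * N ^ Suc k)))"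
      proof -
        have "2 * (real L + real (Suc H)) \<le> 4 * real N" using L elim(2) by simp
        moreover have "(\<Sum>h<Suc H. x h) \<le> (\<Sum>h<Suc H. 2 * real N * (\<gamma> h * N ^ Suc k))"
          using x_le by (intro sum_mono) simp
        moreover have "0 \<le> 4 * real N" by simp
        moreover have "0 \<le> (\<Sum>h<Suc H. x h)" by (intro sum_nonneg) (simp add: x_def)
        moreover have "0 \<le> real (N ^ Suc k)" by simp
        ultimately show ?thesis by (rule mult_left_mono[OF mult_mono])
      qed
      also have "\<dots> = 8 * (N ^ Suc (Suc k))\<^sup>2 * (\<Sum>h<Suc H. \<gamma> h)"
        by (simp add: sum_distrib_left[symmetric] sum_distrib_right[symmetric] power2_eq_square mult_ac del: sum.lessThan_Suc)
      finally have "(norm S / N ^ Suc (Suc k))\<^sup>2 \<le> 8 * ((\<Sum>h<Suc H. \<gamma> h) / Suc H)"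
        using N by (simp add: power_divide field_simps del: sum.lessThan_Suc of_nat_Suc)
      then have "((norm S / N ^ Suc (Suc k))\<^sup>2) ^ p \<le> (8 * ((\<Sum>h<Suc H. \<gamma> h) / Suc H)) ^ p"
        by (intro power_mono) auto
      also have "\<dots> \<le> 8 ^ p * (\<beta>' + 3 * \<eta>)"
        unfolding power_mult_distrib using avg by (intro mult_left_mono) auto
      also have "\<dots> = 8 ^ p * \<beta>' + \<delta>" using \<eta>(2) by (simp add: algebra_simps)
      finally show "(norm S / N ^ Suc (Suc k)) ^ (2 ^ Suc (Suc k)) \<le> 8 ^ (2 ^ Suc k) * \<beta>' + \<delta>"
        by (simp add: p_def power_mult[symmetric])
    qed
  qed
qed

text \<open>A sum over an interval is a difference of two initial sums, each with error at most a
  small multiple of its length plus a constant. As the end points are at most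
  \<open>(B + 1) * N\<close>, this is uniform even over short intervals.\<close>

lemma cube_bound_0:
  assumes "(\<lambda>n. (\<Sum>j<n. c j) / of_nat n) \<longlonglongrightarrow> z"
  shows "cube_bound c 0 ((norm z)\<^sup>2)"
  unfolding cube_bound_def
proof (intro allI impI)
  fix B :: nat and \<delta> :: real assume "\<delta> > 0"
  have "((\<lambda>e::real. (norm z + e)\<^sup>2) \<longlongrightarrow> (norm z + 0)\<^sup>2) (at_right 0)"
    by (intro tendsto_intros)
  then have "eventually (\<lambda>e. (norm z + e)\<^sup>2 < (norm z)\<^sup>2 + \<delta>) (at_right 0)"
    using \<open>\<delta> > 0\<close> by (intro order_tendstoD(2)) auto
  then have "eventually (\<lambda>e::real. (norm z + e)\<^sup>2 < (norm z)\<^sup>2 + \<delta> \<and> 0 < e) (at_right 0)"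
    using eventually_at_right_less by (intro eventually_conj) auto
  then obtain e :: real where e: "e > 0" "(norm z + e)\<^sup>2 < (norm z)\<^sup>2 + \<delta>"
    using eventually_happens'[OF trivial_limit_at_right_real] by blast
  \<comment> \<open>Each initial sum contributes \<open>e * N / 4\<close>, and the constants
    \<open>2 * K\<close> at most \<open>e * N / 2\<close> for large \<open>N\<close>.\<close>
  define \<eta> where "\<eta> = e / (4 * (B + 1))"
  have \<eta>: "\<eta> > 0" using e by (simp add: \<eta>_def)
  define err where "err n = (\<Sum>j<n. c j) - of_nat n * z" for n
  obtain n0 where n0: "\<And>n. n \<ge> n0 \<Longrightarrow> dist ((\<Sum>j<n. c j) / of_nat n) z < \<eta>"
    using tendstoD[OF assms \<eta>] by (auto simp: eventually_sequentially)
  define K where "K = (\<Sum>n\<le>n0. norm (err n))"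
  have K: "K \<ge> 0" by (simp add: K_def sum_nonneg)
  have err: "norm (err n) \<le> \<eta> * n + K" for n
  proof (cases "n \<le> n0")
    case True
    then have "norm (err n) \<le> K" unfolding K_def by (intro member_le_sum) auto
    then show ?thesis using \<eta> by (simp add: add_increasing)
  next
    case False
    then have "n > 0" by simp
    then have "err n = of_nat n * ((\<Sum>j<n. c j) / of_nat n - z)" by (simp add: err_def field_simps)
    then have "norm (err n) = n * dist ((\<Sum>j<n. c j) / of_nat n) z" by (simp add: norm_mult dist_norm)
    also have "\<dots> \<le> n * \<eta>" using n0[of n] False by (intro mult_left_mono) auto
    finally show ?thesis using K by (simp add: mult.commute)
  qed
  have "eventually (\<lambda>N. 4 * K / e \<le> real N) sequentially"
    using eventually_ge_at_top[of "nat \<lceil>4 * K / e\<rceil>"] by eventually_elim linarith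
  then show "\<forall>\<^sub>F N in sequentially. \<forall>F g b L. cube_fun c 0 F \<longrightarrow> (\<forall>xs. norm (g xs) \<le> 1) \<longrightarrow>
      b \<le> B * N \<longrightarrow> L \<le> N \<longrightarrow>
      (norm (cube_sum 0 N g b L F) / N ^ Suc 0) ^ (2 ^ Suc 0) \<le> (norm z)\<^sup>2 + \<delta>"
    using eventually_gt_at_top[of 0]
  proof eventually_elim
    case (elim N)
    show ?case
    proof (intro allI impI)
      fix F and g :: "nat list \<Rightarrow> complex" and b L
      assume F: "cube_fun c 0 F" and g: "\<forall>xs. norm (g xs) \<le> 1" and b: "b \<le> B * N" and L: "L \<le> N"
      have F0: "F m [] = c m" for m using F by cases auto
      have "norm (cube_sum 0 N g b L F) \<le> norm (\<Sum>t\<in>{b..<b+L}. c t)"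
        using g by (simp add: cube_sum_def F0 norm_mult mult_left_le_one_le)
      also have "(\<Sum>t\<in>{b..<b+L}. c t) = (\<Sum>t<b+L. c t) - (\<Sum>t<b. c t)"
        using sum_diff_nat_ivl[of 0 b "b + L" c] by (simp add: atLeast0LessThan)
      also have "\<dots> = err (b + L) - err b + of_nat L * z" by (simp add: err_def algebra_simps)
      also have "norm \<dots> \<le> (norm (err (b + L)) + norm (err b)) + norm (of_nat L * z)"
        by (intro norm_triangle_le add_mono norm_triangle_ineq4 order_refl)
      also have "\<dots> \<le> ((\<eta> * (b + L) + K) + (\<eta> * b + K)) + L * norm z"
        using err[of "b + L"] err[of b] by (simp add: norm_mult)
      also have "\<dots> \<le> ((\<eta> * ((B + 1) * N) + K) + (\<eta> * ((B + 1) * N) + K)) + N * norm z"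
      proof -
        have "b + L \<le> (B + 1) * N" "b \<le> (B + 1) * N" using b L by auto
        then have "real (b + L) \<le> real ((B + 1) * N)" "real b \<le> real ((B + 1) * N)"
          by (simp_all only: of_nat_le_iff)
        then show ?thesis using \<eta> L
          by (intro add_mono mult_left_mono mult_right_mono) auto
      qed
      also have "\<dots> \<le> N * (norm z + e)"
      proof -
        have "\<eta> * ((B + 1) * N) = e * N / 4" by (simp add: \<eta>_def field_simps)
        moreover have "4 * K \<le> e * N" using elim(1) e by (simp add: field_simps)
        ultimately show ?thesis by (simp add: algebra_simps)
      qed
      finally have "norm (cube_sum 0 N g b L F) / N \<le> norm z + e"
        using elim(2) by (simp add: field_simps)
      then have "(norm (cube_sum 0 N g b L F) / N)\<^sup>2 \<le> (norm z + e)\<^sup>2"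
        by (intro power_mono) auto
      then show "(norm (cube_sum 0 N g b L F) / N ^ Suc 0) ^ (2 ^ Suc 0) \<le> (norm z)\<^sup>2 + \<delta>"
        using e by (simp add: power2_eq_square)
    qed
  qed
qed

section \<open>Averages along orbits\<close>

lemma prod_PiE_insert:
  fixes F :: "(nat \<Rightarrow> nat) \<Rightarrow> complex"
  assumes "finite S" "j \<notin> S"
  shows "(\<Prod>\<epsilon>\<in>insert j S \<rightarrow>\<^sub>E {0, 1}. F \<epsilon>) =
    (\<Prod>\<epsilon>\<in>S \<rightarrow>\<^sub>E {0, 1}. F (\<epsilon>(j := 0))) * (\<Prod>\<epsilon>\<in>S \<rightarrow>\<^sub>E {0, 1}. F (\<epsilon>(j := 1)))"
proof -
  have "(\<Prod>\<epsilon>\<in>insert j S \<rightarrow>\<^sub>E {0, 1}. F \<epsilon>) = (\<Prod>(v, \<epsilon>)\<in>{0, 1} \<times> (S \<rightarrow>\<^sub>E {0, 1}). F (\<epsilon>(j := v)))"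
    unfolding PiE_insert_eq by (subst prod.reindex[OF inj_combinator[OF assms(2)]]) (simp add: case_prod_unfold)
  then show ?thesis by (simp flip: prod.cartesian_product)
qed

text \<open>The list of coordinates fixes the order of peeling, so that a chosen coordinate can come
  first.\<close>

fun list_dot :: "nat list \<Rightarrow> (nat \<Rightarrow> nat) \<Rightarrow> nat list \<Rightarrow> nat" where
  "list_dot (j # js) \<epsilon> (i # xs) = \<epsilon> j * i + list_dot js \<epsilon> xs"
| "list_dot _ _ _ = 0"

lemma list_dot_upd: "j \<notin> set js \<Longrightarrow> list_dot js (\<epsilon>(j := v)) xs = list_dot js \<epsilon> xs"
  by (induction js \<epsilon> xs rule: list_dot.induct) auto

lemma list_dot_map: "distinct js \<Longrightarrow> list_dot js \<epsilon> (map i js) = (\<Sum>j\<in>set js. \<epsilon> j * i j)"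
  by (induction js) auto

text \<open>The value of \<open>\<epsilon>0\<close> at the coordinate being peeled decides which
  face carries the remembered factor.\<close>

lemma cube_fun_prod:
  assumes "distinct js" "\<And>\<epsilon> n. norm (a \<epsilon> n) \<le> 1" "\<epsilon>0 \<in> set js \<rightarrow>\<^sub>E {0, 1}"
  shows "cube_fun (a \<epsilon>0) (length js) (\<lambda>m xs. \<Prod>\<epsilon>\<in>set js \<rightarrow>\<^sub>E {0, 1}. a \<epsilon> (m + list_dot js \<epsilon> xs))"
  using assms
proof (induction js arbitrary: a \<epsilon>0)
  case Nil
  have "\<epsilon>0 = (\<lambda>_. undefined)" using Nil(3) by simp
  then show ?case by (simp add: cube_fun.corner)
next
  case (Cons j js)
  let ?V = "set js \<rightarrow>\<^sub>E {0, 1 :: nat}"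
  let ?\<epsilon> = "\<epsilon>0(j := undefined)"
  let ?G = "\<lambda>v m xs. \<Prod>\<epsilon>\<in>?V. a (\<epsilon>(j := v)) (m + list_dot js \<epsilon> xs)"
  have j: "j \<notin> set js" "distinct js" using Cons.prems by auto
  have \<epsilon>: "?\<epsilon> \<in> ?V" using Cons.prems(3) j by (auto simp: PiE_iff extensional_def)
  have IH: "cube_fun (a (\<epsilon>0(j := v))) (length js) (?G v)" for v
    using Cons.IH[OF j(2), of "\<lambda>\<epsilon>. a (\<epsilon>(j := v))", OF Cons.prems(2) \<epsilon>] by (simp only: fun_upd_upd)
  have bound: "norm (?G v m xs) \<le> 1" for v m xs
    unfolding prod_norm[symmetric] using Cons.prems(2) by (intro prod_le_1) auto
  have split: "(\<Prod>\<epsilon>\<in>set (j # js) \<rightarrow>\<^sub>E {0, 1}. a \<epsilon> (m + list_dot (j # js) \<epsilon> (i # xs))) =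
      ?G 0 m xs * ?G 1 (m + i) xs" for m i xs
    using j by (simp add: prod_PiE_insert list_dot_upd add.assoc del: One_nat_def)
  have "\<epsilon>0 j = 0 \<or> \<epsilon>0 j = 1" using Cons.prems(3) by (auto simp: PiE_iff)
  then show ?case
  proof
    assume "\<epsilon>0 j = 0"
    then have "\<epsilon>0(j := 0) = \<epsilon>0" by auto
    then show ?thesis
      using cube_fun.lower[OF IH[of 0] bound[of 1], OF split] by simp
  next
    assume "\<epsilon>0 j = 1"
    then have "\<epsilon>0(j := 1) = \<epsilon>0" by auto
    then show ?thesis
      using cube_fun.upper[OF IH[of 1] bound[of 0], OF split] by simp
  qed
qed

lemma sum_PiE_eq_sum_grid:
  assumes "distinct js"
  shows "(\<Sum>i\<in>set js \<rightarrow>\<^sub>E {0..<N}. F (map i js)) = (\<Sum>xs\<in>grid (length js) N. F xs)"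
proof (rule sum.reindex_bij_betw)
  let ?f = "\<lambda>i. map i js"
  have inj: "inj_on ?f (set js \<rightarrow>\<^sub>E {0..<N})"
    by (intro inj_onI) (auto intro: PiE_ext)
  have "?f ` (set js \<rightarrow>\<^sub>E {0..<N}) \<subseteq> grid (length js) N"
    by (auto simp: grid_def PiE_iff)
  moreover have "card (?f ` (set js \<rightarrow>\<^sub>E {0..<N})) = card (grid (length js) N)"
    using assms by (simp add: card_image[OF inj] card_funcsetE distinct_card)
  ultimately have "?f ` (set js \<rightarrow>\<^sub>E {0..<N}) = grid (length js) N"
    by (intro card_subset_eq finite_grid)
  with inj show "bij_betw ?f (set js \<rightarrow>\<^sub>E {0..<N}) (grid (length js) N)" by (simp add: bij_betw_def)
qed

text \<open>The face with value 0 at \<open>j\<close> does not involve \<open>i j\<close> and serves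
  as the weight \<open>g\<close>, while \<open>i j\<close> itself is the base point of the face
  carrying \<open>\<epsilon>0\<close>.\<close>

lemma sum_cube_eq_cube_sum:
  assumes "j \<in> {1..k}" and a: "\<And>\<epsilon> n. norm (a \<epsilon> n) \<le> 1"
    and \<epsilon>0: "\<epsilon>0 \<in> {1..k} \<rightarrow>\<^sub>E {0, 1}" "\<epsilon>0 j = 1"
  obtains G g where "cube_fun (a \<epsilon>0) (k - 1) G" "\<forall>xs. norm (g xs) \<le> 1"
    "\<And>N. (\<Sum>i\<in>{1..k} \<rightarrow>\<^sub>E {0..<N}. \<Prod>\<epsilon>\<in>{1..k} \<rightarrow>\<^sub>E {0, 1}. a \<epsilon> (index_dot k \<epsilon> i)) = cube_sum (k - 1) N g 0 N G"
proof -
  obtain js where js: "set js = {1..k} - {j}" "distinct js"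
    using finite_distinct_list[of "{1..k} - {j}"] by auto
  then have len: "length js = k - 1" using distinct_card[OF js(2)] assms(1) by (simp add: card_Diff_singleton)
  have j: "j \<notin> set js" using js(1) by simp
  then have dj: "distinct (j # js)" using js(2) by simp
  have set: "set (j # js) = {1..k}" using js(1) assms(1) by (simp add: insert_absorb)
  let ?V = "set js \<rightarrow>\<^sub>E {0, 1 :: nat}"
  let ?G = "\<lambda>v m xs. \<Prod>\<epsilon>\<in>?V. a (\<epsilon>(j := v)) (m + list_dot js \<epsilon> xs)"
  have "\<epsilon>0(j := undefined) \<in> ?V" using \<epsilon>0(1) unfolding set[symmetric] using j
    by (auto simp: PiE_iff extensional_def)
  from cube_fun_prod[OF js(2), of "\<lambda>\<epsilon>. a (\<epsilon>(j := 1))", OF a this]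
  have "cube_fun (a (\<epsilon>0(j := undefined, j := 1))) (length js) (?G 1)" .
  moreover have "\<epsilon>0(j := undefined, j := 1) = \<epsilon>0" using \<epsilon>0(2) by auto
  ultimately have 1: "cube_fun (a \<epsilon>0) (k - 1) (?G 1)" using len by simp
  have 2: "\<forall>xs. norm (?G 0 0 xs) \<le> 1"
    unfolding prod_norm[symmetric] using a by (intro allI prod_le_1) auto
  have 3: "(\<Sum>i\<in>{1..k} \<rightarrow>\<^sub>E {0..<N}. \<Prod>\<epsilon>\<in>{1..k} \<rightarrow>\<^sub>E {0, 1}. a \<epsilon> (index_dot k \<epsilon> i)) =
      cube_sum (k - 1) N (?G 0 0) 0 N (?G 1)" for N
  proof -
    have "(\<Sum>i\<in>{1..k} \<rightarrow>\<^sub>E {0..<N}. \<Prod>\<epsilon>\<in>{1..k} \<rightarrow>\<^sub>E {0, 1}. a \<epsilon> (index_dot k \<epsilon> i)) =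
        (\<Sum>i\<in>set (j # js) \<rightarrow>\<^sub>E {0..<N}. \<Prod>\<epsilon>\<in>set (j # js) \<rightarrow>\<^sub>E {0, 1}. a \<epsilon> (list_dot (j # js) \<epsilon> (map i (j # js))))"
      unfolding list_dot_map[OF dj] set index_dot_def ..
    also have "\<dots> = (\<Sum>xs\<in>grid (Suc (k - 1)) N. \<Prod>\<epsilon>\<in>set (j # js) \<rightarrow>\<^sub>E {0, 1}. a \<epsilon> (list_dot (j # js) \<epsilon> xs))"
      using sum_PiE_eq_sum_grid[OF dj, where F = "\<lambda>xs. \<Prod>\<epsilon>\<in>set (j # js) \<rightarrow>\<^sub>E {0, 1}. a \<epsilon> (list_dot (j # js) \<epsilon> xs)"] len
      by simp
    also have "\<dots> = (\<Sum>i<N. \<Sum>xs\<in>grid (k - 1) N. ?G 0 0 xs * ?G 1 i xs)"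
      unfolding sum_grid_Suc using j by (simp add: prod_PiE_insert list_dot_upd del: One_nat_def)
    also have "\<dots> = cube_sum (k - 1) N (?G 0 0) 0 N (?G 1)"
      unfolding cube_sum_def by (subst sum.swap) (simp add: sum_distrib_left atLeast0LessThan)
    finally show ?thesis .
  qed
  show ?thesis by (rule that[OF 1 2 3])
qed

section \<open>Generic points and bounds by seminorms\<close>

context ergodic_system
begin

primrec iterated_diff :: "('a \<Rightarrow> real) \<Rightarrow> nat list \<Rightarrow> 'a \<Rightarrow> real" where
  "iterated_diff f [] = f"
| "iterated_diff f (h # hs) = (\<lambda>x. iterated_diff f hs x * iterated_diff f hs ((T ^^ h) x))"

text \<open>The lists of shifts are countable and the functions are built from \<open>f\<close>
  alone, so the exceptional null set is chosen before any other factor.\<close>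

definition generic :: "('a \<Rightarrow> real) \<Rightarrow> 'a \<Rightarrow> bool" where
  "generic f x \<longleftrightarrow> (\<forall>hs. (\<lambda>n. (\<Sum>j<n. iterated_diff f hs ((T ^^ j) x)) / n) \<longlonglongrightarrow> (\<integral>x. iterated_diff f hs x \<partial>M))"

lemma AE_generic:
  assumes "f \<in> borel_measurable M" "bounded (f ` space M)"
  shows "AE x in M. generic f x"
proof -
  have "iterated_diff f hs \<in> borel_measurable M \<and> bounded (iterated_diff f hs ` space M)" for hs
    using assms by (induction hs) (auto intro: bounded_measurable_diff)
  then show ?thesis unfolding generic_def AE_all_countable by (auto intro: birkhoff)
qed

text \<open>The last shift of a list acts on \<open>f\<close> first. Hence the lists for
  \<open>f\<close> include all lists for its products with translates, and genericity is
  inherited.\<close>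

lemma iterated_diff_append:
  "iterated_diff f (hs @ [h]) = iterated_diff (\<lambda>x. f x * f ((T ^^ h) x)) hs"
  by (induction hs) auto

lemma generic_diff: "generic f x \<Longrightarrow> generic (\<lambda>x. f x * f ((T ^^ h) x)) x"
  unfolding generic_def by (metis iterated_diff_append)

text \<open>\<open>K\<close> is independent of \<open>f\<close> and \<open>x\<close>, as the
  inductive step passes to the products of \<open>f\<close> with its translates and averages their
  bounds over the shifts.\<close>

lemma cube_bound_orbit:
  "\<exists>K\<ge>0. \<forall>f x. f \<in> borel_measurable M \<longrightarrow> (\<forall>x\<in>space M. \<bar>f x\<bar> \<le> 1) \<longrightarrow> x \<in> space M \<longrightarrow> generic f x \<longrightarrow>
    cube_bound (\<lambda>n. of_real (f ((T ^^ n) x))) k (K * hk_seminorm M T (Suc k) f ^ 2 ^ Suc k)"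
proof (induction k)
  case 0
  show ?case
  proof (intro exI[of _ 1] conjI allI impI)
    fix f :: "'a \<Rightarrow> real" and x assume "generic f x"
    then have "(\<lambda>n. (\<Sum>j<n. f ((T ^^ j) x)) / n) \<longlonglongrightarrow> (\<integral>x. f x \<partial>M)"
      by (auto simp: generic_def dest: spec[of _ "[]"])
    then have "(\<lambda>n. complex_of_real ((\<Sum>j<n. f ((T ^^ j) x)) / n)) \<longlonglongrightarrow> of_real (\<integral>x. f x \<partial>M)"
      by (rule tendsto_of_real)
    then show "cube_bound (\<lambda>n. of_real (f ((T ^^ n) x))) 0 (1 * hk_seminorm M T (Suc 0) f ^ 2 ^ Suc 0)"
      using cube_bound_0[of "\<lambda>n. of_real (f ((T ^^ n) x))" "of_real (\<integral>x. f x \<partial>M)"] by simp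
  qed simp
next
  case (Suc k)
  then obtain K where K: "K \<ge> 0" and IH: "\<And>f x. f \<in> borel_measurable M \<Longrightarrow> \<forall>x\<in>space M. \<bar>f x\<bar> \<le> 1 \<Longrightarrow>
      x \<in> space M \<Longrightarrow> generic f x \<Longrightarrow>
      cube_bound (\<lambda>n. of_real (f ((T ^^ n) x))) k (K * hk_seminorm M T (Suc k) f ^ 2 ^ Suc k)"
    by blast
  show ?case
  proof (intro exI[of _ "8 ^ (2 ^ Suc k) * K"] conjI allI impI)
    fix f :: "'a \<Rightarrow> real" and x
    assume f: "f \<in> borel_measurable M" "\<forall>x\<in>space M. \<bar>f x\<bar> \<le> 1" and x: "x \<in> space M" "generic f x"
    let ?D = "\<lambda>h x. f x * f ((T ^^ h) x)"
    let ?\<beta> = "\<lambda>h. K * hk_seminorm M T (Suc k) (?D h) ^ 2 ^ Suc k"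
    have bdd: "bounded (f ` space M)" using f(2) by (auto simp: bounded_iff)
    have "cube_bound (\<lambda>n. of_real (f ((T ^^ n) x))) (Suc k)
        (8 ^ (2 ^ Suc k) * (K * hk_seminorm M T (Suc (Suc k)) f ^ 2 ^ Suc (Suc k)))"
    proof (rule cube_bound_step)
      show "norm (complex_of_real (f ((T ^^ n) x))) \<le> 1" for n
        using f(2) funpow_in_space[OF x(1)] by simp
      show "cube_bound (\<lambda>n. of_real (f ((T ^^ (n + h)) x)) * cnj (of_real (f ((T ^^ n) x)))) k (?\<beta> h)" for h
      proof -
        have "cube_bound (\<lambda>n. of_real (?D h ((T ^^ n) x))) k (?\<beta> h)"
        proof (rule IH)
          show "\<forall>x\<in>space M. \<bar>?D h x\<bar> \<le> 1"
            using f(2) funpow_in_space by (auto simp: abs_mult intro!: mult_le_one)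
        qed (use f bdd x bounded_measurable_diff generic_diff in auto)
        then show ?thesis by (simp add: funpow_add add.commute[of _ h] mult.commute)
      qed
      show "0 \<le> ?\<beta> h" for h using K by (intro mult_nonneg_nonneg zero_le_even_power) auto
      show "(\<lambda>H. (\<Sum>h=1..H. ?\<beta> h) / H) \<longlonglongrightarrow> K * hk_seminorm M T (Suc (Suc k)) f ^ 2 ^ Suc (Suc k)"
        using tendsto_mult[OF tendsto_const[of K] cube_moment_tendsto[OF f(1) bdd, of "Suc k"]]
        by (simp only: hk_seminorm_power f(1) bdd bounded_measurable_diff sum_distrib_left[symmetric] times_divide_eq_right)
    qed
    then show "cube_bound (\<lambda>n. of_real (f ((T ^^ n) x))) (Suc k)
        (8 ^ (2 ^ Suc k) * K * hk_seminorm M T (Suc (Suc k)) f ^ 2 ^ Suc (Suc k))"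
      by (simp only: mult.assoc)
  qed (use K in auto)
qed

definition cube_average :: "nat \<Rightarrow> ((nat \<Rightarrow> nat) \<Rightarrow> 'a \<Rightarrow> complex) \<Rightarrow> 'a \<Rightarrow> nat \<Rightarrow> complex" where
  "cube_average k f x N = 1 / of_nat N ^ k *
    (\<Sum>i \<in> {1..k} \<rightarrow>\<^sub>E {0..<N}. \<Prod>\<epsilon>\<in>nonzero_vertices k. f \<epsilon> ((T ^^ index_dot k \<epsilon> i) x))"

lemma finite_nonzero_vertices [simp]: "finite (nonzero_vertices k)"
  by (simp add: nonzero_vertices_def finite_PiE)

lemma cube_average_tendsto_0:
  assumes x: "x \<in> space M" "generic \<phi> x"
    and \<phi>: "\<phi> \<in> borel_measurable M" "hk_seminorm M T k \<phi> = 0"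
    and \<epsilon>0: "\<epsilon>0 \<in> nonzero_vertices k" "\<And>x. x \<in> space M \<Longrightarrow> f \<epsilon>0 x = of_real (\<phi> x)"
    and f: "\<And>\<epsilon> x. \<epsilon> \<in> nonzero_vertices k \<Longrightarrow> x \<in> space M \<Longrightarrow> norm (f \<epsilon> x) \<le> 1"
  shows "cube_average k f x \<longlonglongrightarrow> 0"
proof -
  \<comment> \<open>The constant 1 at the vertex 0 completes the product to the full cube.\<close>
  define a where "a \<epsilon> n = (if \<epsilon> \<in> nonzero_vertices k then f \<epsilon> ((T ^^ n) x) else 1)" for \<epsilon> n
  have V: "\<epsilon>0 \<in> {1..k} \<rightarrow>\<^sub>E {0, 1}" and "\<epsilon>0 \<noteq> (\<lambda>j\<in>{1..k}. 0)"
    using \<epsilon>0(1) by (auto simp: nonzero_vertices_def)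
  then obtain j where "\<epsilon>0 j \<noteq> (\<lambda>j\<in>{1..k}. 0) j" by (meson ext)
  \<comment> \<open>Outside \<open>{1..k}\<close> both extensional functions are
    \<open>undefined\<close>, so they differ inside.\<close>
  moreover from this have "j \<in> {1..k}" using PiE_arb[OF V, of j] by (cases "j \<in> {1..k}") auto
  ultimately have j: "j \<in> {1..k}" "\<epsilon>0 j = 1" using PiE_mem[OF V, of j] by auto
  then obtain k' where k: "k = Suc k'" by (cases k) auto
  have a: "norm (a \<epsilon> n) \<le> 1" for \<epsilon> n using f funpow_in_space[OF x(1)] by (simp add: a_def)
  have a0: "a \<epsilon>0 = (\<lambda>n. of_real (\<phi> ((T ^^ n) x)))"
    using \<epsilon>0 funpow_in_space[OF x(1)] by (intro ext) (simp add: a_def)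
  have prod_a: "(\<Prod>\<epsilon>\<in>{1..k} \<rightarrow>\<^sub>E {0, 1}. a \<epsilon> (index_dot k \<epsilon> i)) =
      (\<Prod>\<epsilon>\<in>nonzero_vertices k. f \<epsilon> ((T ^^ index_dot k \<epsilon> i) x))" for i
    by (rule prod.mono_neutral_cong_right) (auto simp: a_def nonzero_vertices_def finite_PiE)
  obtain G g where G: "cube_fun (a \<epsilon>0) k' G" "\<forall>xs. norm (g xs) \<le> 1"
    "\<And>N. (\<Sum>i\<in>{1..k} \<rightarrow>\<^sub>E {0..<N}. \<Prod>\<epsilon>\<in>{1..k} \<rightarrow>\<^sub>E {0, 1}. a \<epsilon> (index_dot k \<epsilon> i)) = cube_sum k' N g 0 N G"
    using sum_cube_eq_cube_sum[of j k a \<epsilon>0, OF j(1) a V j(2)] unfolding k by auto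
  have "\<bar>\<phi> y\<bar> \<le> 1" if "y \<in> space M" for y
    using f[OF \<epsilon>0(1) that] \<epsilon>0(2)[OF that] by simp
  then have le: "\<forall>y\<in>space M. \<bar>\<phi> y\<bar> \<le> 1" by blast
  obtain K where K: "\<forall>f x. f \<in> borel_measurable M \<longrightarrow> (\<forall>x\<in>space M. \<bar>f x\<bar> \<le> 1) \<longrightarrow> x \<in> space M \<longrightarrow>
      generic f x \<longrightarrow> cube_bound (\<lambda>n. of_real (f ((T ^^ n) x))) k' (K * hk_seminorm M T (Suc k') f ^ 2 ^ Suc k')"
    using cube_bound_orbit[of k'] by (elim exE conjE)
  have "cube_bound (\<lambda>n. of_real (\<phi> ((T ^^ n) x))) k' (K * hk_seminorm M T (Suc k') \<phi> ^ 2 ^ Suc k')"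
    by (rule K[THEN spec, THEN spec, THEN mp, THEN mp, THEN mp, THEN mp, OF \<phi>(1) le x])
  then have bound: "cube_bound (a \<epsilon>0) k' 0"
    using \<phi>(2) unfolding a0 k by (simp del: hk_seminorm.simps power_Suc add: power_0_left)
  show ?thesis
  proof (rule tendstoI)
    fix e :: real assume "e > 0"
    then have "e ^ 2 ^ Suc k' / 2 > 0" by simp
    then have "\<forall>\<^sub>F N in sequentially. (norm (cube_sum k' N g 0 N G) / N ^ Suc k') ^ 2 ^ Suc k' \<le> 0 + e ^ 2 ^ Suc k' / 2"
      using bound[unfolded cube_bound_def, rule_format, of "e ^ 2 ^ Suc k' / 2" 0] G(1,2)
      by (auto elim!: eventually_mono simp del: power_Suc)
    then show "\<forall>\<^sub>F N in sequentially. dist (cube_average k f x N) 0 < e"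
    proof eventually_elim
      case (elim N)
      have "dist (cube_average k f x N) 0 = norm (cube_sum k' N g 0 N G) / N ^ Suc k'"
        unfolding cube_average_def prod_a[symmetric] G(3) by (simp add: k norm_mult norm_divide norm_power)
      moreover have "(norm (cube_sum k' N g 0 N G) / N ^ Suc k') ^ 2 ^ Suc k' < e ^ 2 ^ Suc k'"
        using elim \<open>e ^ 2 ^ Suc k' / 2 > 0\<close> by linarith
      ultimately show ?case using \<open>e > 0\<close> power_less_imp_less_base[of _ "2 ^ Suc k'" e] by simp
    qed
  qed
qed

end

section \<open>Multilinear replacement by conditional expectations\<close>

locale characteristic_factor = ergodic_system M T
  for M :: "'a measure" and T +
  fixes k :: nat and Z :: "'a measure"
  assumes k: "k \<ge> 1" and hk: "host_kra_factor M T (k - 1) Z"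
begin

sublocale finite_measure_subalgebra M Z
  using hk by unfold_locales (simp add: host_kra_factor_def)

text \<open>Division of all factors by a common bound reaches the normalisation of
  \<open>cube_average_tendsto_0\<close>; it scales the averages by a constant and keeps the
  conditional expectation zero.\<close>

lemma AE_cube_average_real:
  assumes \<phi>: "\<phi> \<in> borel_measurable M" "AE x in M. real_cond_exp M Z \<phi> x = 0"
    and \<epsilon>0: "\<epsilon>0 \<in> nonzero_vertices k" "\<And>x. f \<epsilon>0 x = of_real (\<phi> x)"
    and f: "\<And>\<epsilon>. \<epsilon> \<in> nonzero_vertices k \<Longrightarrow> bounded (f \<epsilon> ` space M)"
  shows "AE x in M. cube_average k f x \<longlonglongrightarrow> 0"
proof -
  have "bounded ((\<Union>\<epsilon>\<in>nonzero_vertices k. f \<epsilon> ` space M))"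
    using f by (intro bounded_UN) auto
  then obtain B where B: "B > 0" "\<And>\<epsilon> x. \<epsilon> \<in> nonzero_vertices k \<Longrightarrow> x \<in> space M \<Longrightarrow> norm (f \<epsilon> x) \<le> B"
    by (auto simp: bounded_pos)
  define \<psi> where "\<psi> x = (1 / B) * \<phi> x" for x
  have \<psi>_meas: "\<psi> \<in> borel_measurable M" using \<phi>(1) unfolding \<psi>_def by measurable
  have le: "\<bar>\<phi> x\<bar> \<le> B" if "x \<in> space M" for x using B(2)[OF \<epsilon>0(1) that] \<epsilon>0(2) by simp
  have bdd: "bounded (\<phi> ` space M)" using le by (auto simp: bounded_iff)
  have \<psi>_bdd: "bounded (\<psi> ` space M)"
    using le B(1) by (auto simp: bounded_iff \<psi>_def abs_mult field_simps intro!: exI[of _ 1])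
  have "AE x in M. real_cond_exp M Z \<psi> x = 0"
    using real_cond_exp_cmult[OF integrable_bounded[OF \<phi>(1) bdd], of "1 / B"] \<phi>(2)
    unfolding \<psi>_def[abs_def] by eventually_elim simp
  then have hk0: "hk_seminorm M T k \<psi> = 0"
    using hk k \<psi>_meas \<psi>_bdd by (simp add: host_kra_factor_def)
  show ?thesis using AE_generic[OF \<psi>_meas \<psi>_bdd] AE_space
  proof eventually_elim
    case (elim x)
    have "cube_average k (\<lambda>\<epsilon> x. f \<epsilon> x / of_real B) x \<longlonglongrightarrow> 0"
      by (rule cube_average_tendsto_0[OF elim(2,1) \<psi>_meas hk0 \<epsilon>0(1)])
        (use B \<epsilon>0(2) in \<open>auto simp: \<psi>_def norm_divide\<close>)
    from tendsto_mult[OF tendsto_const[of "of_real B ^ card (nonzero_vertices k)"] this]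
    have "(\<lambda>N. of_real B ^ card (nonzero_vertices k) * cube_average k (\<lambda>\<epsilon> x. f \<epsilon> x / of_real B) x N) \<longlonglongrightarrow> 0"
      by simp
    moreover have "of_real B ^ card (nonzero_vertices k) * cube_average k (\<lambda>\<epsilon> x. f \<epsilon> x / of_real B) x N =
        cube_average k f x N" for N
      using B(1) by (simp add: cube_average_def prod_dividef sum_divide_distrib[symmetric])
    ultimately show ?case by simp
  qed
qed

lemma cube_average_linear:
  assumes "\<epsilon>0 \<in> nonzero_vertices k" "\<And>x. f \<epsilon>0 x = u x + c * v x"
  shows "cube_average k f x N = cube_average k (f(\<epsilon>0 := u)) x N + c * cube_average k (f(\<epsilon>0 := v)) x N"
proof -
  let ?W = "nonzero_vertices k - {\<epsilon>0}"
  have split: "(\<Prod>\<epsilon>\<in>nonzero_vertices k. (f(\<epsilon>0 := w)) \<epsilon> ((T ^^ index_dot k \<epsilon> i) x)) =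
      w ((T ^^ index_dot k \<epsilon>0 i) x) * (\<Prod>\<epsilon>\<in>?W. f \<epsilon> ((T ^^ index_dot k \<epsilon> i) x))" for w i
    using assms(1) by (subst prod.remove[of _ \<epsilon>0]) auto
  show ?thesis
    unfolding cube_average_def split split[of "f \<epsilon>0", unfolded fun_upd_triv] assms(2)
    by (simp only: distrib_right sum.distrib mult.assoc flip: sum_distrib_left) (simp add: algebra_simps)
qed

text \<open>The seminorms see real functions only, so real and imaginary parts are treated
  separately and recombined by linearity in one vertex.\<close>

lemma AE_cube_average_complex:
  assumes [measurable]: "h \<in> borel_measurable M" and h: "bounded (h ` space M)"
    "AE x in M. real_cond_exp M Z (\<lambda>x. Re (h x)) x = 0" "AE x in M. real_cond_exp M Z (\<lambda>x. Im (h x)) x = 0"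
    and \<epsilon>0: "\<epsilon>0 \<in> nonzero_vertices k"
    and f: "\<And>\<epsilon>. \<epsilon> \<in> nonzero_vertices k \<Longrightarrow> bounded (f \<epsilon> ` space M)"
  shows "AE x in M. cube_average k (f(\<epsilon>0 := h)) x \<longlonglongrightarrow> 0"
proof -
  obtain B where B: "\<And>x. x \<in> space M \<Longrightarrow> norm (h x) \<le> B" using h(1) by (auto simp: bounded_iff)
  have bdd: "bounded ((f(\<epsilon>0 := \<lambda>x. of_real (p (h x)))) \<epsilon> ` space M)"
    if "\<epsilon> \<in> nonzero_vertices k" "\<And>z. \<bar>p z\<bar> \<le> norm z" for p :: "complex \<Rightarrow> real" and \<epsilon>
    using f[OF that(1)] B order_trans[OF that(2)] by (auto simp: bounded_iff intro!: exI[of _ B])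
  have "AE x in M. cube_average k (f(\<epsilon>0 := \<lambda>x. of_real (Re (h x)))) x \<longlonglongrightarrow> 0"
    by (rule AE_cube_average_real[OF _ h(2) \<epsilon>0 _ bdd]) (auto simp: abs_Re_le_cmod)
  moreover have "AE x in M. cube_average k (f(\<epsilon>0 := \<lambda>x. of_real (Im (h x)))) x \<longlonglongrightarrow> 0"
    by (rule AE_cube_average_real[OF _ h(3) \<epsilon>0 _ bdd]) (auto simp: abs_Im_le_cmod)
  ultimately show ?thesis
  proof eventually_elim
    case (elim x)
    have "cube_average k (f(\<epsilon>0 := h)) x = (\<lambda>N. cube_average k (f(\<epsilon>0 := \<lambda>x. of_real (Re (h x)))) x N +
        \<i> * cube_average k (f(\<epsilon>0 := \<lambda>x. of_real (Im (h x)))) x N)"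
    proof
      fix N
      show "cube_average k (f(\<epsilon>0 := h)) x N = cube_average k (f(\<epsilon>0 := \<lambda>x. of_real (Re (h x)))) x N +
          \<i> * cube_average k (f(\<epsilon>0 := \<lambda>x. of_real (Im (h x)))) x N"
      using cube_average_linear[OF \<epsilon>0, of "f(\<epsilon>0 := h)" "\<lambda>x. of_real (Re (h x))" \<i> "\<lambda>x. of_real (Im (h x))" x N]
      by (simp add: complex_eq[symmetric])
    qed
    then show ?case
      using tendsto_add[OF elim(1) tendsto_mult[OF tendsto_const[of \<i>] elim(2)]] by simp
  qed
qed

text \<open>Telescoping over the vertices: adding one vertex to \<open>W\<close> changes the average
  by one containing \<open>f \<epsilon> - Ef \<epsilon>\<close>, of vanishing conditional
  expectation. The intermediate families mix \<open>f\<close> and \<open>Ef\<close>, which is where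
  bounded versions are needed.\<close>

lemma AE_cube_average_difference:
  assumes f: "\<And>\<epsilon>. \<epsilon> \<in> nonzero_vertices k \<Longrightarrow> f \<epsilon> \<in> borel_measurable M"
      "\<And>\<epsilon>. \<epsilon> \<in> nonzero_vertices k \<Longrightarrow> bounded (f \<epsilon> ` space M)"
    and Ef: "\<And>\<epsilon>. \<epsilon> \<in> nonzero_vertices k \<Longrightarrow> bounded_cond_exp_version M Z (f \<epsilon>) (Ef \<epsilon>)"
  shows "AE x in M. (\<lambda>N. cube_average k f x N - cube_average k Ef x N) \<longlonglongrightarrow> 0"
proof -
  have EfD: "Ef \<epsilon> \<in> borel_measurable Z" "Ef \<epsilon> \<in> borel_measurable M" "bounded (Ef \<epsilon> ` space M)"
    "AE x in M. Ef \<epsilon> x = complex_cond_exp M Z (f \<epsilon>) x" if "\<epsilon> \<in> nonzero_vertices k" for \<epsilon>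
    using Ef[OF that] measurable_from_subalg[OF subalg] by (auto simp: bounded_cond_exp_version_def)
  \<comment> \<open>Applied to \<open>Re\<close> and \<open>Im\<close>. As
    \<open>Ef \<epsilon>\<close> is measurable for \<open>Z\<close>, it is its own conditional
    expectation.\<close>
  have cond_exp_0: "AE x in M. real_cond_exp M Z (\<lambda>x. p (f \<epsilon> x - Ef \<epsilon> x)) x = 0"
    if \<epsilon>: "\<epsilon> \<in> nonzero_vertices k" and p: "bounded_linear p"
      "AE x in M. p (Ef \<epsilon> x) = real_cond_exp M Z (\<lambda>x. p (f \<epsilon> x)) x" for \<epsilon> and p :: "complex \<Rightarrow> real"
  proof -
    have [measurable]: "p \<in> borel_measurable borel"
      using p(1) by (intro borel_measurable_continuous_onI linear_continuous_on)
    have int: "integrable M (\<lambda>x. p (g x))" if "g \<in> borel_measurable M" "bounded (g ` space M)" for g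
      using bounded_linear_image[OF that(2) p(1)] that(1) by (intro integrable_bounded) (auto simp: image_image)
    have "AE x in M. real_cond_exp M Z (\<lambda>x. p (f \<epsilon> x) - p (Ef \<epsilon> x)) x =
        real_cond_exp M Z (\<lambda>x. p (f \<epsilon> x)) x - real_cond_exp M Z (\<lambda>x. p (Ef \<epsilon> x)) x"
      using f EfD \<epsilon> by (intro real_cond_exp_diff int)
    moreover have "AE x in M. real_cond_exp M Z (\<lambda>x. p (Ef \<epsilon> x)) x = p (Ef \<epsilon> x)"
      using EfD[OF \<epsilon>] by (intro real_cond_exp_F_meas int) auto
    ultimately show ?thesis using p(2)
      by eventually_elim (simp add: linear_diff[OF bounded_linear.linear[OF p(1)]])
  qed
  have replace: "AE x in M. cube_average k (g(\<epsilon> := \<lambda>x. f \<epsilon> x - Ef \<epsilon> x)) x \<longlonglongrightarrow> 0"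
    if "\<epsilon> \<in> nonzero_vertices k" "\<And>\<epsilon>. \<epsilon> \<in> nonzero_vertices k \<Longrightarrow> bounded (g \<epsilon> ` space M)" for g \<epsilon>
  proof (rule AE_cube_average_complex)
    show "AE x in M. real_cond_exp M Z (\<lambda>x. Re (f \<epsilon> x - Ef \<epsilon> x)) x = 0"
      using EfD(4)[OF that(1)] by (intro cond_exp_0 that bounded_linear_Re) (auto simp: complex_cond_exp_def)
    show "AE x in M. real_cond_exp M Z (\<lambda>x. Im (f \<epsilon> x - Ef \<epsilon> x)) x = 0"
      using EfD(4)[OF that(1)] by (intro cond_exp_0 that bounded_linear_Im) (auto simp: complex_cond_exp_def)
  qed (use that f EfD in \<open>auto intro!: bounded_minus_comp\<close>)
  have "finite W \<Longrightarrow> W \<subseteq> nonzero_vertices k \<Longrightarrow>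
    AE x in M. (\<lambda>N. cube_average k (\<lambda>\<epsilon>. if \<epsilon> \<in> W then f \<epsilon> else Ef \<epsilon>) x N - cube_average k Ef x N) \<longlonglongrightarrow> 0" for W
  proof (induction rule: finite_induct)
    case (insert \<epsilon> W)
    let ?g = "\<lambda>W \<epsilon>. if \<epsilon> \<in> W then f \<epsilon> else Ef \<epsilon>"
    have \<epsilon>: "\<epsilon> \<in> nonzero_vertices k" using insert by simp
    have "AE x in M. cube_average k ((?g W)(\<epsilon> := \<lambda>x. f \<epsilon> x - Ef \<epsilon> x)) x \<longlonglongrightarrow> 0"
      using \<epsilon> f EfD by (intro replace) auto
    moreover have "AE x in M. (\<lambda>N. cube_average k (?g W) x N - cube_average k Ef x N) \<longlonglongrightarrow> 0"
      using insert by simp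
    ultimately show ?case
    proof eventually_elim
      case (elim x)
      have *: "(?g W)(\<epsilon> := Ef \<epsilon>) = ?g W" "(?g (insert \<epsilon> W))(\<epsilon> := w) = (?g W)(\<epsilon> := w)" for w
        using insert(2) by (intro ext; auto)+
      have "cube_average k (?g (insert \<epsilon> W)) x N =
          cube_average k ((?g W)(\<epsilon> := \<lambda>x. f \<epsilon> x - Ef \<epsilon> x)) x N + cube_average k (?g W) x N" for N
        using cube_average_linear[OF \<epsilon>, of "?g (insert \<epsilon> W)" "\<lambda>x. f \<epsilon> x - Ef \<epsilon> x" 1 "Ef \<epsilon>" x N]
        unfolding * by simp
      then show ?case using tendsto_add[OF elim] by (simp add: add_diff_eq)
    qed
  qed simp
  from this[OF finite_nonzero_vertices order_refl]
  have "AE x in M. (\<lambda>N. cube_average k (\<lambda>\<epsilon>. if \<epsilon> \<in> nonzero_vertices k then f \<epsilon> else Ef \<epsilon>) x N -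
      cube_average k Ef x N) \<longlonglongrightarrow> 0" .
  then show ?thesis by (simp add: cube_average_def cong: prod.cong)
qed

end

theorem theorem2:
  fixes M :: "'a measure" and T :: "'a \<Rightarrow> 'a" and k :: nat and Z :: "'a measure"
    and f Ef :: "(nat \<Rightarrow> nat) \<Rightarrow> 'a \<Rightarrow> complex"
  assumes "ergodic_system M T"
    and "k \<ge> 1"
    and "host_kra_factor M T (k - 1) Z"
    and "\<And>\<epsilon>. \<epsilon> \<in> nonzero_vertices k \<Longrightarrow> f \<epsilon> \<in> borel_measurable M"
    and "\<And>\<epsilon>. \<epsilon> \<in> nonzero_vertices k \<Longrightarrow> bounded (f \<epsilon> ` space M)"
    and "\<And>\<epsilon>. \<epsilon> \<in> nonzero_vertices k \<Longrightarrow> bounded_cond_exp_version M Z (f \<epsilon>) (Ef \<epsilon>)"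
  shows "AE x in M.
    (\<lambda>N. 1 / of_nat N ^ k *
       (\<Sum>i \<in> {1..k} \<rightarrow>\<^sub>E {0..<N}.
          (\<Prod>\<epsilon>\<in>nonzero_vertices k. f \<epsilon> ((T ^^ index_dot k \<epsilon> i) x)) -
          (\<Prod>\<epsilon>\<in>nonzero_vertices k. Ef \<epsilon> ((T ^^ index_dot k \<epsilon> i) x))))
    \<longlonglongrightarrow> 0"
proof -
  interpret ergodic_system M T by fact
  interpret characteristic_factor M T k Z by unfold_locales fact+
  show ?thesis
    using AE_cube_average_difference[OF assms(4-6)]
    by (simp add: cube_average_def sum_subtractf right_diff_distrib)
qed

end
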